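(* Let $\mathcal{P}$ be a closed path polyomino. Then $\mathrm{ht}(I_{\mathcal{P}})=\mathrm{rank}(\mathcal{P})$.
   Context: Cells and polyominoes: for $a=(i,j)\le b=(k,l)$ in $\mathbb{Z}^2$ (componentwise order), $[a,b]=\{(p,q)\in\mathbb{Z}^2: i\le p\le k,\ j\le q\le l\}$ is an interval; it is proper if $i<k$ and $j<l$. The anti-diagonal corners of a proper interval are $c=(i,l)$, $d=(k,j)$. A cell is an interval $C=[a,a+(1,1)]$; $V(C)$ is the set of its four corners and its edges are its four sides. A polyomino $\mathcal{P}$ is a non-empty finite set of cells such that any two of its cells can be joined by a sequence of cells of $\mathcal{P}$ in which consecutive cells share an edge. $V(\mathcal{P})=\bigcup_{C\in\mathcal{P}}V(C)$ and $\mathrm{rank}(\mathcal{P})$ is the number of cells of $\mathcal{P}$. Polyomino ideal: a proper interval $[a,b]$ is an inner interval of $\mathcal{P}$ if every cell contained in $[a,b]$ belongs to $\mathcal{P}$. Let $K$ be a field and $S_{\mathcal{P}}=K[x_v: v\in V(\mathcal{P})]$. $I_{\mathcal{P}}\subset S_{\mathcal{P}}$ is the ideal generated by the inner $2$-minors $x_ax_b-x_cx_d$, for all inner intervals $[a,b]$ of $\mathcal{P}$ with anti-diagonal corners $c,d$. Closed path: a polyomino $\mathcal{P}$ is a closed path if its cells can be listed as $A_1,\dots,A_n$, $n>5$, with $A_{n+1}=A_1$ (indices modulo $n$), such that: $A_i\cap A_{i+1}$ is a common edge for all $i=1,\dots,n$; $A_i\ne A_j$ for $i\ne j$ in $\{1,\dots,n\}$;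 and for all $i$ and all $j\notin\{i-2,i-1,i,i+1,i+2\}$ (indices modulo $n$) one has $V(A_i)\cap V(A_j)=\emptyset$. *)

theory Defs
  imports "HOL-Algebra.Ideal" "HOL-Library.Poly_Mapping" "HOL-Library.Extended_Nat"
begin

type_synonym point = "int \<times> int"

definition lattice_interval :: "point \<Rightarrow> point \<Rightarrow> point set" where
  "lattice_interval a b = {fst a..fst b} \<times> {snd a..snd b}"

definition proper_interval :: "point \<Rightarrow> point \<Rightarrow> bool" where
  "proper_interval a b \<longleftrightarrow> fst a < fst b \<and> snd a < snd b"

text \<open>
  A cell is a set of lattice points, so it coincides with the set of its four corners:
  \<open>V(C) = C\<close>. Edges are represented by their two end points.
\<close>

definition cell :: "point \<Rightarrow> point set" where
  "cell a = lattice_interval a (fst a + 1, snd a + 1)"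

definition cell_edges :: "point set \<Rightarrow> point set set" where
  "cell_edges C = {e. \<exists>i j. C = cell (i, j) \<and>
     e \<in> {{(i, j), (i + 1, j)}, {(i, j + 1), (i + 1, j + 1)},
          {(i, j), (i, j + 1)}, {(i + 1, j), (i + 1, j + 1)}}}"

definition share_edge :: "point set \<Rightarrow> point set \<Rightarrow> bool" where
  "share_edge C D \<longleftrightarrow> cell_edges C \<inter> cell_edges D \<noteq> {}"

definition polyomino :: "point set set \<Rightarrow> bool" where
  "polyomino P \<longleftrightarrow> P \<noteq> {} \<and> finite P \<and> P \<subseteq> range cell \<and>
     (\<forall>C\<in>P. \<forall>D\<in>P. \<exists>Cs. Cs \<noteq> [] \<and> set Cs \<subseteq> P \<and> hd Cs = C \<and> last Cs = D \<and>
        successively share_edge Cs)"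

definition polyomino_vertices :: "point set set \<Rightarrow> point set" where
  "polyomino_vertices P = \<Union>P"

definition polyomino_rank :: "point set set \<Rightarrow> nat" where
  "polyomino_rank P = card P"

definition inner_interval :: "point set set \<Rightarrow> point \<Rightarrow> point \<Rightarrow> bool" where
  "inner_interval P a b \<longleftrightarrow> proper_interval a b \<and>
     (\<forall>c. cell c \<subseteq> lattice_interval a b \<longrightarrow> cell c \<in> P)"

text \<open>
  The cells \<open>A\<^sub>1, \<dots>, A\<^sub>n\<close> are listed as \<open>As ! 0, \<dots>, As ! (n - 1)\<close>; indices are cyclic.
\<close>

definition closed_path :: "point set set \<Rightarrow> bool" where
  "closed_path P \<longleftrightarrow> polyomino P \<and>
     (\<exists>As n. length As = n \<and> n > 5 \<and> set As = P \<and> distinct As \<and>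
        (\<forall>i<n. As ! i \<inter> As ! (Suc i mod n)
                 \<in> cell_edges (As ! i) \<inter> cell_edges (As ! (Suc i mod n))) \<and>
        (\<forall>i<n. \<forall>j<n. (\<forall>d\<in>{-2..2}. int j \<noteq> (int i + d) mod int n)
                 \<longrightarrow> As ! i \<inter> As ! j = {}))"

type_synonym 'k mpoly = "(point \<Rightarrow>\<^sub>0 nat) \<Rightarrow>\<^sub>0 'k"

definition Var :: "point \<Rightarrow> 'k::field mpoly" where
  "Var v = Poly_Mapping.single (Poly_Mapping.single v 1) 1"

text \<open>
  The polynomial ring \<open>K[x\<^sub>v : v \<in> V(P)]\<close>, as a ring with explicit carrier: ideals and
  prime ideals have to be taken in exactly these variables.
\<close>

definition polyomino_ring :: "point set set \<Rightarrow> 'k::field mpoly ring" where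
  "polyomino_ring P =
     \<lparr>carrier = {f. \<forall>m \<in> Poly_Mapping.keys f. Poly_Mapping.keys m \<subseteq> polyomino_vertices P},
      mult = (*), one = 1, zero = 0, add = (+)\<rparr>"

definition inner_minor :: "point \<Rightarrow> point \<Rightarrow> 'k::field mpoly" where
  "inner_minor a b = Var a * Var b - Var (fst a, snd b) * Var (fst b, snd a)"

definition polyomino_ideal :: "point set set \<Rightarrow> 'k::field mpoly set" where
  "polyomino_ideal P = Idl\<^bsub>polyomino_ring P\<^esub> {inner_minor a b | a b. inner_interval P a b}"

text \<open>
  The height of a prime ideal is the supremum of the lengths (numbers of strict inclusions)
  of chains of prime ideals ending in it; the height of an arbitrary ideal is the infimum of
  the heights of the prime ideals containing it.
\<close>

definition prime_height :: "('a, 'b) ring_scheme \<Rightarrow> 'a set \<Rightarrow> enat" where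
  "prime_height R p = Sup {enat n | n. \<exists>q. q n = p \<and> (\<forall>i\<le>n. primeideal (q i) R) \<and>
     (\<forall>i<n. q i \<subset> q (Suc i))}"

definition ideal_height :: "('a, 'b) ring_scheme \<Rightarrow> 'a set \<Rightarrow> enat" where
  "ideal_height R I = (INF p \<in> {p. primeideal p R \<and> I \<subseteq> p}. prime_height R p)"

end

theory Submission
  imports Defs "HOL-Library.Product_Lexorder"
begin

text \<open>
  Upper bound: the integer weights on the vertices that satisfy the equations of the \<open>card P\<close> cells
  define a toric prime containing the ideal, and elimination yields \<open>card V - card P\<close> variables that
  are algebraically independent modulo it. Passing to a strictly smaller prime adjoins one more
  independent element, and at most \<open>card V\<close> polynomials in \<open>card V\<close> variables are independent.

  Lower bound: let \<open>p\<close> be a prime containing the ideal. If \<open>T\<close> is a maximal set of variables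
  independent modulo \<open>p\<close>, contracting \<open>p\<close> along the other variables one at a time gives a chain of
  \<open>card V - card T\<close> strict inclusions. To bound \<open>card T\<close>, let \<open>Z\<close> be the set of vertices whose
  variable lies in \<open>p\<close>. The vertices of the path are partitioned into the pairs
  \<open>A\<^sub>i\<^sub>+\<^sub>1 - A\<^sub>i\<close>. Each pair either meets \<open>Z\<close>, or it provides an inner interval (the cell
  \<open>A\<^sub>i\<^sub>+\<^sub>1\<close> or the domino \<open>A\<^sub>i \<union> A\<^sub>i\<^sub>+\<^sub>1\<close>) with corners outside \<open>Z\<close>, or it is compensated by the
  preceding pair lying entirely in \<open>Z\<close>. The intervals so obtained have no cell in common, so their
  binomials are linearly independent relations between the variables outside \<open>p\<close>.
\<close>

abbreviation "keys \<equiv> Poly_Mapping.keys"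
abbreviation "lookup \<equiv> Poly_Mapping.lookup"
abbreviation "single \<equiv> Poly_Mapping.single"

section \<open>Linear equations over an integral domain\<close>

text \<open>Fraction-free Gaussian elimination, one equation at a time. \<open>B\<close> holds the
  coordinates that are still free, and each new equation costs at most one of them. The induction
  starts with the unit vectors.\<close>

lemma elimination:
  fixes A :: "'i \<Rightarrow> 'b \<Rightarrow> 'r::idom"
  assumes "finite I" and V: "finite V"
  shows "\<exists>B w. B \<subseteq> V \<and> card V \<le> card B + card I \<and>
    (\<forall>b\<in>B. w b b \<noteq> 0 \<and> (\<forall>b'\<in>B - {b}. w b b' = 0) \<and> (\<forall>i\<in>I. (\<Sum>v\<in>V. A i v * w b v) = 0))"
  using assms(1)
proof (induction I rule: finite_induct)
  case empty
  show ?case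
    by (rule exI[of _ V], rule exI[of _ "\<lambda>b v. if v = b then 1 else 0"]) auto
next
  case (insert i I)
  then obtain B w where B: "B \<subseteq> V" "card V \<le> card B + card I"
    and w: "\<And>b. b \<in> B \<Longrightarrow> w b b \<noteq> 0" "\<And>b b'. b \<in> B \<Longrightarrow> b' \<in> B \<Longrightarrow> b' \<noteq> b \<Longrightarrow> w b b' = 0"
      "\<And>b j. b \<in> B \<Longrightarrow> j \<in> I \<Longrightarrow> (\<Sum>v\<in>V. A j v * w b v) = 0"
    by blast
  define a where "a b = (\<Sum>v\<in>V. A i v * w b v)" for b
  show ?case
  proof (cases "\<forall>b\<in>B. a b = 0")
    case True
    then show ?thesis
      using B w insert.hyps by (intro exI[of _ B] exI[of _ w]) (auto simp: a_def)
  next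
    case False
    then obtain b0 where b0: "b0 \<in> B" "a b0 \<noteq> 0"
      by blast
    \<comment> \<open>Cross-multiplication with the pivot \<open>b0\<close> cancels the new equation
      without division. At \<open>b\<close> the value becomes \<open>a b0 * w b b\<close>, because
      \<open>w b0 b = 0\<close>, and it stays nonzero in a domain.\<close>
    define w' where "w' b v = a b0 * w b v - a b * w b0 v" for b v
    have sum_w': "(\<Sum>v\<in>V. A j v * w' b v) =
        a b0 * (\<Sum>v\<in>V. A j v * w b v) - a b * (\<Sum>v\<in>V. A j v * w b0 v)" for j b
      by (simp add: w'_def algebra_simps sum_subtractf sum_distrib_left)
    have "(\<Sum>v\<in>V. A j v * w' b v) = 0" if "b \<in> B - {b0}" "j \<in> insert i I" for j b
      using that b0 w(3) unfolding sum_w' by (auto simp flip: a_def)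
    moreover have "card B = Suc (card (B - {b0}))"
      using b0 B V by (metis card_Suc_Diff1 finite_subset)
    ultimately show ?thesis
      using B w b0 insert.hyps
      by (intro exI[of _ "B - {b0}"] exI[of _ w']) (auto simp: w'_def)
  qed
qed

lemma nontrivial_solution:
  fixes A :: "'i \<Rightarrow> 'b \<Rightarrow> 'r::idom"
  assumes "finite I" "finite V" "card I < card V"
  shows "\<exists>w. (\<exists>v\<in>V. w v \<noteq> 0) \<and> (\<forall>i\<in>I. (\<Sum>v\<in>V. A i v * w v) = 0)"
proof -
  obtain B w where B: "B \<subseteq> V" "card V \<le> card B + card I"
    and w: "\<And>b. b \<in> B \<Longrightarrow> w b b \<noteq> 0 \<and> (\<forall>i\<in>I. (\<Sum>v\<in>V. A i v * w b v) = 0)"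
    using elimination[OF assms(1,2), of A] by blast
  from B assms(3) have "B \<noteq> {}"
    by auto
  then obtain b where "b \<in> B"
    by blast
  then show ?thesis
    using w[of b] B by blast
qed

section \<open>Polynomials\<close>

lemma mpoly_induct [case_names zero single add]:
  assumes "P 0" "\<And>m c. P (single m c)" "\<And>f g. P f \<Longrightarrow> P g \<Longrightarrow> P (f + g)"
  shows "P (f :: 'm \<Rightarrow>\<^sub>0 'a::comm_monoid_add)"
proof -
  have "P (\<Sum>m\<in>M. single m (lookup f m))" if "finite M" for M
    using that by (induction M rule: finite_induct) (auto intro: assms)
  moreover have "(\<Sum>m\<in>keys f. single m (lookup f m)) = f"
    by (rule poly_mapping_eqI) (auto simp: lookup_sum lookup_single when_def in_keys_iff)
  ultimately show ?thesis
    by (metis finite_keys)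
qed

section \<open>Additive maps defined term by term\<close>

text \<open>\<open>H m\<close> may be any additive map of the coefficient at \<open>m\<close>, so
  one construction yields both the transport of exponents and the extraction of
  coefficients.\<close>

definition linear_ext :: "('m \<Rightarrow> 'a \<Rightarrow> 'c) \<Rightarrow> ('m \<Rightarrow>\<^sub>0 'a::comm_monoid_add) \<Rightarrow> 'c::comm_monoid_add" where
  "linear_ext H f = (\<Sum>m\<in>keys f. H m (lookup f m))"

lemma linear_ext_zero [simp]: "linear_ext H 0 = 0"
  by (simp add: linear_ext_def)

lemma linear_ext_add:
  assumes "\<And>m. H m 0 = 0" "\<And>m a b. H m (a + b) = H m a + H m b"
  shows "linear_ext H (f + g) = linear_ext H f + linear_ext H g"
  unfolding linear_ext_def using assms by (intro setsum_keys_plus_distrib) auto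

lemma linear_ext_single:
  assumes "H m 0 = 0"
  shows "linear_ext H (single m c) = H m c"
  using assms by (simp add: linear_ext_def)

text \<open>For additive \<open>h\<close> this is the ring homomorphism that \<open>h\<close>
  induces on monoid algebras; its kernel will be the toric ideal.\<close>

definition map_exponents :: "('m \<Rightarrow> 'n) \<Rightarrow> ('m \<Rightarrow>\<^sub>0 'a::comm_monoid_add) \<Rightarrow> ('n \<Rightarrow>\<^sub>0 'a)" where
  "map_exponents h = linear_ext (\<lambda>m c. single (h m) c)"

lemma map_exponents_simps [simp]:
  "map_exponents h 0 = 0"
  "map_exponents h (single m c) = single (h m) c"
  "map_exponents h (f + g) = map_exponents h f + map_exponents h g"
  unfolding map_exponents_def by (simp_all add: linear_ext_single linear_ext_add single_add)

lemma map_exponents_diff: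
  "map_exponents h (f - g) = map_exponents h f - map_exponents h (g :: 'm \<Rightarrow>\<^sub>0 'a::ab_group_add)"
  by (metis map_exponents_simps(3) add_diff_cancel diff_add_cancel)

lemma map_exponents_mult:
  fixes f g :: "'m::monoid_add \<Rightarrow>\<^sub>0 'a::semiring_0"
  assumes h: "\<And>m m'. h (m + m') = h m + h m'"
  shows "map_exponents h (f * g) = map_exponents h f * map_exponents h g"
proof (induction f rule: mpoly_induct)
  case (single m c)
  show ?case
    by (induction g rule: mpoly_induct) (simp_all add: mult_single h distrib_left)
qed (simp_all add: distrib_right)

text \<open>The coefficient of \<open>y\<^sup>j\<close> when \<open>f\<close> is read as a polynomial in \<open>y\<close>.\<close>

definition coef :: "'v \<Rightarrow> nat \<Rightarrow> (('v \<Rightarrow>\<^sub>0 nat) \<Rightarrow>\<^sub>0 'k) \<Rightarrow> (('v \<Rightarrow>\<^sub>0 nat) \<Rightarrow>\<^sub>0 'k::field)" where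
  "coef y j = linear_ext (\<lambda>m c. single (m - single y j) c when lookup m y = j)"

lemma coef_simps [simp]:
  "coef y j 0 = 0"
  "coef y j (single m c) = (single (m - single y j) c when lookup m y = j)"
  "coef y j (f + g) = coef y j f + coef y j g"
  unfolding coef_def by (simp_all add: linear_ext_single linear_ext_add single_add when_add_distrib)

lemma coef_mult: "coef y j (f * g) = (\<Sum>i\<le>j. coef y i f * coef y (j - i) g)"
proof (induction f rule: mpoly_induct)
  case (single m c)
  show ?case
  proof (induction g rule: mpoly_induct)
    case (single m' c')
    let ?Y = "single y"
    \<comment> \<open>Subtraction of exponents truncates at zero; the identity survives because
      exactly the power of \<open>y\<close> present in each monomial is removed.\<close>
    have "m - ?Y (lookup m y) + (m' - ?Y (lookup m' y)) = m + m' - ?Y (lookup m y + lookup m' y)"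
      by (rule poly_mapping_eqI) (auto simp: lookup_add lookup_minus lookup_single when_def)
    moreover have "(\<Sum>i\<le>j. coef y i (single m c) * coef y (j - i) (single m' c'))
       = (\<Sum>i\<le>j. if i = lookup m y then coef y i (single m c) * coef y (j - i) (single m' c') else 0)"
      by (intro sum.cong) auto
    ultimately show ?case
      by (auto simp: mult_single lookup_add when_def)
  qed (simp_all add: distrib_left sum.distrib)
qed (simp_all add: distrib_right sum.distrib)

section \<open>Polynomials in a prescribed set of variables\<close>

definition pols :: "'v set \<Rightarrow> (('v \<Rightarrow>\<^sub>0 nat) \<Rightarrow>\<^sub>0 'k::field) set" where
  "pols V = {f. \<forall>m\<in>keys f. keys m \<subseteq> V}"

lemma pols_zero [simp]: "0 \<in> pols V"
  and pols_one [simp]: "1 \<in> pols V"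
  and pols_single: "keys m \<subseteq> V \<Longrightarrow> single m c \<in> pols V"
  and pols_const [simp]: "single 0 c \<in> pols V"
  and pols_uminus: "f \<in> pols V \<Longrightarrow> - f \<in> pols V"
  by (auto simp: pols_def in_keys_iff[of _ "- f"] in_keys_iff[of _ f])

lemma pols_add: "f \<in> pols V \<Longrightarrow> g \<in> pols V \<Longrightarrow> f + g \<in> pols V"
  using keys_add[of f g] by (auto simp: pols_def)

lemma pols_diff: "f \<in> pols V \<Longrightarrow> g \<in> pols V \<Longrightarrow> f - g \<in> pols V"
  using pols_add[OF _ pols_uminus, of f V g] by simp

lemma pols_mult:
  assumes "f \<in> pols V" "g \<in> pols V"
  shows "f * g \<in> pols V"
  unfolding pols_def mem_Collect_eq
proof
  fix m
  assume "m \<in> keys (f * g)"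
  then obtain a b where "m = a + b" "a \<in> keys f" "b \<in> keys g"
    using keys_mult[of f g] by blast
  then show "keys m \<subseteq> V"
    using assms keys_add[of a b] unfolding pols_def by blast
qed

lemma pols_power: "f \<in> pols V \<Longrightarrow> f ^ n \<in> pols V"
  by (induction n) (simp_all add: pols_mult)

lemma pols_prod: "(\<And>i. i \<in> I \<Longrightarrow> F i \<in> pols V) \<Longrightarrow> prod F I \<in> pols V"
  by (induction I rule: infinite_finite_induct) (simp_all add: pols_mult)

lemma pols_sum: "(\<And>i. i \<in> I \<Longrightarrow> F i \<in> pols V) \<Longrightarrow> sum F I \<in> pols V"
  by (induction I rule: infinite_finite_induct) (simp_all add: pols_add)

lemma pols_mono: "V \<subseteq> W \<Longrightarrow> pols V \<subseteq> pols W"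
  by (auto simp: pols_def)

lemma pols_induct [consumes 1, case_names zero single add]:
  assumes "f \<in> pols V" "P 0" "\<And>m c. keys m \<subseteq> V \<Longrightarrow> P (single m c)"
    "\<And>f g. P f \<Longrightarrow> P g \<Longrightarrow> P (f + g)"
  shows "P f"
proof -
  have "P (\<Sum>m\<in>M. single m (lookup f m))" if "finite M" "M \<subseteq> keys f" for M
    using that assms(1) by (induction M rule: finite_induct) (auto simp: pols_def intro: assms)
  moreover have "(\<Sum>m\<in>keys f. single m (lookup f m)) = f"
    by (rule poly_mapping_eqI) (auto simp: lookup_sum lookup_single when_def in_keys_iff)
  ultimately show ?thesis
    by (metis finite_keys subset_refl)
qed

lemma coef_pols:
  assumes "f \<in> pols V"
  shows "coef y j f \<in> pols (V - {y})"
  using assms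
proof (induction f rule: pols_induct)
  case (single m c)
  have "keys (m - single y (lookup m y)) \<subseteq> V - {y}"
    using single by (auto simp: in_keys_iff lookup_minus lookup_single when_def subset_iff split: if_splits)
  then show ?case
    by (auto simp: when_def intro: pols_single)
qed (simp_all add: pols_add)

lemma coef_free:
  assumes "f \<in> pols V" "y \<notin> V"
  shows "coef y j f = (f when j = 0)"
  using assms(1)
proof (induction f rule: pols_induct)
  case (single m c)
  then have "lookup m y = 0"
    using assms(2) by (auto simp: in_keys_iff)
  then show ?case
    by (auto simp: when_def)
qed (simp_all add: when_add_distrib)

lemma coef_expansion: "\<exists>N. f = (\<Sum>j<N. coef y j f * single (single y j) 1)"
proof -
  \<comment> \<open>Proving the expansion for all large \<open>N\<close> lets the bounds of two
    summands be merged by taking the maximum.\<close>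
  have "\<exists>N0. \<forall>N\<ge>N0. f = (\<Sum>j<N. coef y j f * single (single y j) 1)"
  proof (induction f rule: mpoly_induct)
    case (single m c)
    have "(\<Sum>j<N. coef y j (single m c) * single (single y j) 1)
      = (\<Sum>j<N. if j = lookup m y then single m c else 0)" for N
    proof (intro sum.cong refl)
      fix j
      have "m - single y (lookup m y) + single y (lookup m y) = m"
        by (rule poly_mapping_eqI) (auto simp: lookup_add lookup_minus lookup_single when_def)
      then show "coef y j (single m c) * single (single y j) 1
          = (if j = lookup m y then single m c else 0)"
        by (auto simp: mult_single)
    qed
    then show ?case
      by (intro exI[of _ "Suc (lookup m y)"]) auto
  next
    case (add f g)
    then obtain N1 N2 where "\<forall>N\<ge>N1. f = (\<Sum>j<N. coef y j f * single (single y j) 1)"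
      "\<forall>N\<ge>N2. g = (\<Sum>j<N. coef y j g * single (single y j) 1)"
      by blast
    then show ?case
      by (intro exI[of _ "max N1 N2"]) (auto simp: distrib_right sum.distrib)
  qed simp
  then show ?thesis
    by blast
qed

section \<open>Prime ideals of polynomial rings\<close>

definition polynomial_ring :: "'v set \<Rightarrow> (('v \<Rightarrow>\<^sub>0 nat) \<Rightarrow>\<^sub>0 'k::field) ring" where
  "polynomial_ring V = \<lparr>carrier = pols V, mult = (*), one = 1, zero = 0, add = (+)\<rparr>"

lemma polynomial_ring_simps [simp]:
  "carrier (polynomial_ring V) = pols V" "mult (polynomial_ring V) = (*)"
  "one (polynomial_ring V) = 1" "zero (polynomial_ring V) = 0" "add (polynomial_ring V) = (+)"
  by (simp_all add: polynomial_ring_def)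

lemma cring_polynomial_ring: "cring (polynomial_ring V)"
proof (rule cringI)
  show "abelian_group (polynomial_ring V)"
    by (rule abelian_groupI) (auto simp: pols_add add_ac intro!: bexI[of _ "- _"] pols_uminus)
  show "comm_monoid (polynomial_ring V)"
    by (rule comm_monoidI) (auto simp: pols_mult mult_ac)
qed (auto simp: distrib_right)

text \<open>Primality unfolded inside \<open>pols V\<close>, so that ideal computations use the
  arithmetic of the ambient polynomial type rather than the record operations of
  \<open>polynomial_ring V\<close>.\<close>

locale polynomial_prime =
  fixes V :: "'v set" and p :: "(('v \<Rightarrow>\<^sub>0 nat) \<Rightarrow>\<^sub>0 'k::field) set"
  assumes subset: "p \<subseteq> pols V"
    and zero: "0 \<in> p"
    and add: "\<And>f g. f \<in> p \<Longrightarrow> g \<in> p \<Longrightarrow> f + g \<in> p"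
    and mult: "\<And>f g. f \<in> p \<Longrightarrow> g \<in> pols V \<Longrightarrow> g * f \<in> p"
    and one: "1 \<notin> p"
    and prime: "\<And>f g. f \<in> pols V \<Longrightarrow> g \<in> pols V \<Longrightarrow> f * g \<in> p \<Longrightarrow> f \<in> p \<or> g \<in> p"
begin

lemma uminus: "f \<in> p \<Longrightarrow> - f \<in> p"
  using mult[of f "- 1"] by (simp add: pols_uminus)

lemma diff: "f \<in> p \<Longrightarrow> g \<in> p \<Longrightarrow> f - g \<in> p"
  using add[OF _ uminus, of f g] by simp

lemma sum: "(\<And>i. i \<in> I \<Longrightarrow> F i \<in> p) \<Longrightarrow> sum F I \<in> p"
  by (induction I rule: infinite_finite_induct) (simp_all add: zero add)

lemma power: "f \<in> pols V \<Longrightarrow> f \<notin> p \<Longrightarrow> f ^ n \<notin> p"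
proof (induction n)
  case (Suc n)
  then show ?case
    using prime[of f "f ^ n"] pols_power[of f V n] by auto
qed (simp add: one)

lemma const: "single 0 c \<in> p \<Longrightarrow> c = 0"
  using mult[of "single 0 c" "single 0 (inverse c)"] one
  by (cases "c = 0") (simp_all add: mult_single)

end

lemma primeideal_polynomial_ring_iff:
  "primeideal p (polynomial_ring V) \<longleftrightarrow> polynomial_prime V p"
proof
  assume "primeideal p (polynomial_ring V)"
  then interpret primeideal p "polynomial_ring V" .
  show "polynomial_prime V p"
  proof
    show "1 \<notin> p"
      using one_imp_carrier I_notcarr by auto
  qed (use a_subset I_prime in \<open>auto intro: I_l_closed[simplified] additive_subgroup.a_closed[OF is_additive_subgroup, simplified]
        additive_subgroup.zero_closed[OF is_additive_subgroup, simplified]\<close>)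
next
  assume "polynomial_prime V p"
  then interpret p: polynomial_prime V p .
  interpret R: cring "polynomial_ring V"
    by (rule cring_polynomial_ring)
  show "primeideal p (polynomial_ring V)"
  proof (rule primeidealI)
    show "ideal p (polynomial_ring V)"
    proof (rule idealI)
      show "subgroup p (add_monoid (polynomial_ring V))"
      proof (rule group.subgroupI)
        fix f assume f: "f \<in> p"
        have "inv\<^bsub>add_monoid (polynomial_ring V)\<^esub> f = - f"
          using f p.subset
          by (intro group.inv_equality[OF R.a_group]) (auto intro: pols_uminus)
        then show "inv\<^bsub>add_monoid (polynomial_ring V)\<^esub> f \<in> p"
          using f p.uminus by simp
      qed (use p.subset p.zero p.add R.a_group[simplified] in auto)
    qed (use p.mult in \<open>auto simp: R.ring_axioms mult.commute\<close>)
    show "carrier (polynomial_ring V) \<noteq> p"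
      using p.one by auto
  qed (use p.prime R.is_cring in auto)
qed

section \<open>Contraction along a variable and chains of primes\<close>

text \<open>This is the extension to K[V] of the contraction of \<open>p\<close> to K[V - {y}]:
  membership in an extended ideal is decided by the coefficients of the powers of \<open>y\<close>,
  in which \<open>y\<close> does not occur.\<close>

definition contract_extend :: "'v \<Rightarrow> 'v set \<Rightarrow> (('v \<Rightarrow>\<^sub>0 nat) \<Rightarrow>\<^sub>0 'k::field) set \<Rightarrow> (('v \<Rightarrow>\<^sub>0 nat) \<Rightarrow>\<^sub>0 'k) set" where
  "contract_extend y V p = {f \<in> pols V. \<forall>j. coef y j f \<in> p}"

context polynomial_prime
begin

lemma coef_in_pols: "f \<in> pols V \<Longrightarrow> coef y j f \<in> pols V"
  by (rule subsetD[OF pols_mono[of "V - {y}" V] coef_pols]) auto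

lemma contract_extend_subset:
  assumes "y \<in> V"
  shows "contract_extend y V p \<subseteq> p"
proof
  fix f
  assume f: "f \<in> contract_extend y V p"
  obtain N where N: "f = (\<Sum>j<N. coef y j f * single (single y j) 1)"
    by (rule exE[OF coef_expansion[of f y]])
  have "coef y j f * single (single y j) 1 \<in> p" for j
  proof -
    have "coef y j f \<in> p"
      using f by (simp add: contract_extend_def)
    then show ?thesis
      using mult[OF _ pols_single[of "single y j" V 1], of "coef y j f"] assms
      by (simp add: mult.commute subset_iff in_keys_iff lookup_single when_def)
  qed
  then show "f \<in> p"
    by (subst N) (rule sum)
qed

lemma contract_extend_free:
  assumes "f \<in> p" "f \<in> pols W" "W \<subseteq> V" "y \<notin> W"
  shows "f \<in> contract_extend y V p"
  using assms pols_mono[of W V] by (auto simp: contract_extend_def coef_free[OF assms(2,4)] when_def zero)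

text \<open>As for Gauss' lemma: multiply the lowest coefficients lying outside \<open>p\<close>.\<close>

lemma contract_extend_prime:
  assumes "y \<in> V"
  shows "polynomial_prime V (contract_extend y V p)"
proof
  show "f + g \<in> contract_extend y V p"
    if "f \<in> contract_extend y V p" "g \<in> contract_extend y V p" for f g
    using that by (auto simp: contract_extend_def add pols_add)
  show "g * f \<in> contract_extend y V p" if "f \<in> contract_extend y V p" "g \<in> pols V" for f g
    using that unfolding contract_extend_def
    by (auto simp: coef_mult pols_mult intro!: sum mult coef_in_pols)
  show "1 \<notin> contract_extend y V p"
    using contract_extend_subset[OF assms] one by blast
  show "f \<in> contract_extend y V p \<or> g \<in> contract_extend y V p"
    if f: "f \<in> pols V" and g: "g \<in> pols V" and fg: "f * g \<in> contract_extend y V p" for f g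
  proof (rule ccontr)
    assume neg: "\<not> ?thesis"
    define a where "a = (LEAST j. coef y j f \<notin> p)"
    define b where "b = (LEAST j. coef y j g \<notin> p)"
    from neg f g have ex: "\<exists>j. coef y j f \<notin> p" "\<exists>j. coef y j g \<notin> p"
      by (auto simp: contract_extend_def)
    have a: "coef y a f \<notin> p" "\<And>j. j < a \<Longrightarrow> coef y j f \<in> p"
      unfolding a_def using LeastI_ex[OF ex(1)] not_less_Least by blast+
    have b: "coef y b g \<notin> p" "\<And>j. j < b \<Longrightarrow> coef y j g \<in> p"
      unfolding b_def using LeastI_ex[OF ex(2)] not_less_Least by blast+
    have "coef y (a + b) (f * g) - (\<Sum>i\<in>{..a + b} - {a}. coef y i f * coef y (a + b - i) g)
        = coef y a f * coef y b g"
      by (simp add: coef_mult sum.remove[of "{..a + b}" a])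
    moreover have "coef y i f * coef y (a + b - i) g \<in> p" if "i \<in> {..a + b} - {a}" for i
    proof (cases "i < a")
      case True
      then show ?thesis
        using mult[OF a(2)] g by (metis coef_in_pols mult.commute)
    next
      case False
      then have "a + b - i < b"
        using that by auto
      then show ?thesis
        using mult[OF b(2)] f by (metis coef_in_pols)
    qed
    moreover have "coef y (a + b) (f * g) \<in> p"
      using fg by (auto simp: contract_extend_def)
    ultimately have "coef y a f * coef y b g \<in> p"
      by (metis (no_types, lifting) diff sum)
    then show False
      using prime a(1) b(1) f g coef_in_pols by blast
  qed
qed (auto simp: contract_extend_def zero)

end

text \<open>Contracting along \<open>y\<close> keeps every relation in which \<open>y\<close> does
  not occur, hence those of the other members of \<open>Y\<close>, and stays inside
  \<open>p\<close>, so \<open>T\<close> remains independent. Only the relation for \<open>y\<close>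
  itself is lost, which makes the inclusion strict.\<close>

lemma chain_below_prime:
  assumes "finite Y" "polynomial_prime V p" "T \<union> Y \<subseteq> V" "T \<inter> Y = {}" "p \<inter> pols T \<subseteq> {0}"
    and "\<And>y. y \<in> Y \<Longrightarrow> \<exists>g\<in>p. g \<noteq> 0 \<and> g \<in> pols (insert y T)"
  shows "\<exists>q. q (card Y) = p \<and> (\<forall>i\<le>card Y. polynomial_prime V (q i)) \<and> (\<forall>i<card Y. q i \<subset> q (Suc i))"
  using assms
proof (induction Y arbitrary: p rule: finite_induct)
  case empty
  then show ?case
    by (intro exI[of _ "\<lambda>_. p"]) auto
next
  case (insert y Y)
  interpret polynomial_prime V p
    by fact
  let ?q = "contract_extend y V p"
  have y: "y \<in> V" "y \<notin> T"
    using insert.prems by auto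
  have sub: "?q \<subseteq> p"
    using contract_extend_subset[OF y(1)] .
  have "\<exists>q. q (card Y) = ?q \<and> (\<forall>i\<le>card Y. polynomial_prime V (q i)) \<and> (\<forall>i<card Y. q i \<subset> q (Suc i))"
  proof (rule insert.IH)
    show "polynomial_prime V ?q"
      by (rule contract_extend_prime) fact
    show "\<exists>g\<in>?q. g \<noteq> 0 \<and> g \<in> pols (insert z T)" if z: "z \<in> Y" for z
    proof -
      obtain g where "g \<in> p" "g \<noteq> 0" "g \<in> pols (insert z T)"
        using insert.prems(5) z by blast
      then show ?thesis
        using contract_extend_free[of g "insert z T" y] insert.prems insert.hyps z y by blast
    qed
  qed (use insert.prems sub in auto)
  then obtain q where q: "q (card Y) = ?q" "\<And>i. i \<le> card Y \<Longrightarrow> polynomial_prime V (q i)"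
    "\<And>i. i < card Y \<Longrightarrow> q i \<subset> q (Suc i)"
    by blast
  obtain g where g: "g \<in> p" "g \<noteq> 0" "g \<in> pols (insert y T)"
    using insert.prems(5) by blast
  \<comment> \<open>The coefficients of \<open>g\<close> in \<open>y\<close> lie in
    \<open>pols T\<close>; if they were also in \<open>p\<close>, they would vanish, and
    \<open>g\<close> with them.\<close>
  have "g \<notin> ?q"
  proof
    assume "g \<in> ?q"
    have "coef y j g = 0" for j
    proof -
      have "coef y j g \<in> pols T"
        using coef_pols[OF g(3), of y j] y(2) pols_mono[of "insert y T - {y}" T] by blast
      then show ?thesis
        using \<open>g \<in> ?q\<close> insert.prems(4) by (auto simp: contract_extend_def)
    qed
    then show False
      using coef_expansion[of g y] g(2) by simp
  qed
  then have "?q \<subset> p"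
    using sub g(1) by blast
  then have step: "q i \<subset> (if Suc i \<le> card Y then q (Suc i) else p)" if "i \<le> card Y" for i
    using q(1) q(3)[of i] that by (cases "i = card Y") auto
  have "card (insert y Y) = Suc (card Y)"
    using insert.hyps by simp
  then show ?case
    using q(2) step insert.prems(1)
    by (intro exI[of _ "\<lambda>i. if i \<le> card Y then q i else p"]) (simp add: less_Suc_eq_le)
qed

text \<open>If \<open>T\<close> is a maximal independent set of variables, every further variable
  satisfies a nonzero relation over \<open>T\<close> in \<open>p\<close>, which is what the chain
  construction consumes.\<close>

lemma prime_height_ge:
  assumes V: "finite V" and p: "polynomial_prime V p"
    and bound: "\<And>T. T \<subseteq> V \<Longrightarrow> p \<inter> pols T \<subseteq> {0} \<Longrightarrow> card T + n \<le> card V"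
  shows "enat n \<le> prime_height (polynomial_ring V) p"
proof -
  interpret polynomial_prime V p
    by fact
  let ?indep = "\<lambda>T. T \<subseteq> V \<and> p \<inter> pols T \<subseteq> {0}"
  \<comment> \<open>A polynomial without variables is a constant, and a prime contains no nonzero
    constant; so independent sets exist, and among finitely many one is maximal.\<close>
  have "p \<inter> pols {} \<subseteq> {0}"
  proof
    fix f
    assume f: "f \<in> p \<inter> pols {}"
    then have "f = single 0 (lookup f 0)"
      by (intro poly_mapping_eqI) (auto simp: pols_def lookup_single when_def in_keys_iff)
    then show "f \<in> {0}"
      using f const[of "lookup f 0"] by auto
  qed
  then have "finite (Collect ?indep)" "Collect ?indep \<noteq> {}"
    using V by (auto intro: finite_subset[OF _ finite_Pow_iff[THEN iffD2, OF V]])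
  then obtain T where "T \<in> Collect ?indep" "\<forall>T'\<in>Collect ?indep. T \<subseteq> T' \<longrightarrow> T = T'"
    by (rule bexE[OF finite_has_maximal])
  then have T: "?indep T" "\<And>T'. ?indep T' \<Longrightarrow> T \<subseteq> T' \<Longrightarrow> T' = T"
    by simp_all metis
  define Y where "Y = V - T"
  have "\<exists>g\<in>p. g \<noteq> 0 \<and> g \<in> pols (insert y T)" if "y \<in> Y" for y
  proof -
    have "insert y T \<subseteq> V" "insert y T \<noteq> T"
      using that T(1) by (auto simp: Y_def)
    then have "\<not> p \<inter> pols (insert y T) \<subseteq> {0}"
      using T(2)[of "insert y T"] by (metis subset_insertI)
    then show ?thesis
      by auto
  qed
  then have chain: "\<exists>q. q (card Y) = p \<and> (\<forall>i\<le>card Y. polynomial_prime V (q i)) \<and> (\<forall>i<card Y. q i \<subset> q (Suc i))"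
    using T(1) V p by (intro chain_below_prime[of Y V p T]) (auto simp: Y_def)
  have "enat (card Y) \<le> prime_height (polynomial_ring V) p"
    unfolding prime_height_def primeideal_polynomial_ring_iff
    by (rule Sup_upper, rule CollectI, rule exI[of _ "card Y"], rule conjI[OF refl chain])
  moreover have "card T + card Y = card V"
    unfolding Y_def using T(1) V by (metis card_Diff_subset card_mono finite_subset le_add_diff_inverse)
  then have "n \<le> card Y"
    using bound[of T] T(1) by linarith
  ultimately show ?thesis
    by (meson enat_ord_simps(1) order_trans)
qed

section \<open>Algebraic independence modulo a prime\<close>

text \<open>Exponent vectors, taken extensional so that they can be counted.\<close>

definition box :: "'a set \<Rightarrow> nat \<Rightarrow> ('a \<Rightarrow> nat) set" where
  "box F D = (\<Pi>\<^sub>E f\<in>F. {..<D})"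

lemma finite_box: "finite F \<Longrightarrow> finite (box F D)"
  and card_box: "finite F \<Longrightarrow> card (box F D) = D ^ card F"
  and box_less: "\<alpha> \<in> box F D \<Longrightarrow> f \<in> F \<Longrightarrow> \<alpha> f < D"
  by (auto simp: box_def finite_PiE card_PiE dest: PiE_mem)

definition box_poly ::
  "(((('v \<Rightarrow>\<^sub>0 nat) \<Rightarrow>\<^sub>0 'k) \<Rightarrow> nat) \<Rightarrow> 'k) \<Rightarrow> (('v \<Rightarrow>\<^sub>0 nat) \<Rightarrow>\<^sub>0 'k::field) set \<Rightarrow> nat \<Rightarrow> (('v \<Rightarrow>\<^sub>0 nat) \<Rightarrow>\<^sub>0 'k)" where
  "box_poly c F D = (\<Sum>\<alpha>\<in>box F D. single 0 (c \<alpha>) * (\<Prod>f\<in>F. f ^ \<alpha> f))"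

text \<open>For finite \<open>F\<close>, testing boxes loses nothing: every polynomial relation fits
  in a large enough box, padded with zero coefficients.\<close>

definition alg_indep :: "(('v \<Rightarrow>\<^sub>0 nat) \<Rightarrow>\<^sub>0 'k::field) set \<Rightarrow> (('v \<Rightarrow>\<^sub>0 nat) \<Rightarrow>\<^sub>0 'k) set \<Rightarrow> bool" where
  "alg_indep q F \<longleftrightarrow> (\<forall>c D. box_poly c F D \<in> q \<longrightarrow> (\<forall>\<alpha>\<in>box F D. c \<alpha> = 0))"

lemma box_poly_insert:
  assumes "finite F" "f \<notin> F"
  shows "box_poly c (insert f F) D = (\<Sum>j<D. f ^ j * box_poly (\<lambda>\<beta>. c (\<beta>(f := j))) F D)"
proof -
  have *: "(\<Prod>g\<in>F. g ^ (if g = f then j else \<beta> g)) = (\<Prod>g\<in>F. g ^ \<beta> g)" for \<beta> j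
    using assms(2) by (intro prod.cong) auto
  have "box_poly c (insert f F) D =
      (\<Sum>(j, \<beta>)\<in>{..<D} \<times> box F D. f ^ j * (single 0 (c (\<beta>(f := j))) * (\<Prod>g\<in>F. g ^ \<beta> g)))"
    unfolding box_poly_def box_def PiE_insert_eq
    using assms by (subst sum.reindex[OF inj_combinator[OF assms(2)]])
      (auto simp: * mult_ac intro!: sum.cong)
  also have "\<dots> = (\<Sum>j<D. f ^ j * box_poly (\<lambda>\<beta>. c (\<beta>(f := j))) F D)"
    by (simp add: box_poly_def sum.cartesian_product sum_distrib_left)
  finally show ?thesis .
qed

lemma box_poly_pols: "F \<subseteq> pols V \<Longrightarrow> box_poly c F D \<in> pols V"
  unfolding box_poly_def by (intro pols_sum pols_mult pols_const pols_prod pols_power) auto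

text \<open>A relation for \<open>f\<close> modulo \<open>q\<close> may be divided by powers of \<open>f \<notin> q\<close>, and then its
  constant term is a relation modulo \<open>q'\<close>.\<close>

lemma alg_indep_insert:
  assumes q: "polynomial_prime V q" and q': "polynomial_prime V q'" and "q \<subseteq> q'"
    and f: "f \<in> q'" "f \<notin> q" and F: "finite F" "F \<subseteq> pols V" "alg_indep q' F" and "f \<notin> F"
  shows "alg_indep q (insert f F)"
  unfolding alg_indep_def
proof (intro allI impI)
  interpret q: polynomial_prime V q by fact
  interpret q': polynomial_prime V q' by fact
  fix c D
  assume mem: "box_poly c (insert f F) D \<in> q"
  define h where "h j = box_poly (\<lambda>\<beta>. c (\<beta>(f := j))) F D" for j
  have fV: "f \<in> pols V" and h: "h j \<in> pols V" for j
    using f(1) q'.subset F(2) by (auto simp: h_def intro: box_poly_pols)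
  \<comment> \<open>Strong induction from the lowest power of \<open>f\<close>: once the layers
    below \<open>j\<close> vanish, \<open>f ^ j\<close> factors out and can be cancelled modulo the
    prime \<open>q\<close>.\<close>
  have zero: "\<forall>\<beta>\<in>box F D. c (\<beta>(f := j)) = 0" if "j < D" for j
    using that
  proof (induction j rule: less_induct)
    case (less j)
    have "h i = 0" if "i < j" for i
    proof -
      have "\<forall>\<beta>\<in>box F D. c (\<beta>(f := i)) = 0"
        using that less.prems by (intro less.IH) auto
      then show ?thesis
        unfolding h_def box_poly_def by (intro sum.neutral) (simp del: fun_upd_apply)
    qed
    then have "(\<Sum>i<D. f ^ i * h i) = (\<Sum>i\<in>{j..<D}. f ^ i * h i)"
      using less.prems by (intro sum.mono_neutral_right) auto
    also have "\<dots> = f ^ j * (\<Sum>i\<in>{j..<D}. f ^ (i - j) * h i)"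
      by (auto simp: sum_distrib_left mult.assoc[symmetric] power_add[symmetric] intro!: sum.cong)
    finally have "f ^ j * (\<Sum>i\<in>{j..<D}. f ^ (i - j) * h i) \<in> q"
      using mem F(1) \<open>f \<notin> F\<close> by (simp add: box_poly_insert h_def)
    moreover have "(\<Sum>i\<in>{j..<D}. f ^ (i - j) * h i) \<in> pols V"
      by (intro pols_sum pols_mult pols_power fV h)
    ultimately have "(\<Sum>i\<in>{j..<D}. f ^ (i - j) * h i) \<in> q"
      using q.prime[of "f ^ j"] q.power[OF fV f(2)] pols_power[OF fV] by blast
    moreover have "{j..<D} = insert j {Suc j..<D}"
      using less.prems by auto
    ultimately have "h j + (\<Sum>i\<in>{Suc j..<D}. f ^ (i - j) * h i) \<in> q'"
      using \<open>q \<subseteq> q'\<close> by auto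
    moreover have "f ^ (i - j) * h i \<in> q'" if "i \<in> {Suc j..<D}" for i
    proof -
      have "f ^ (i - j) * h i = (f ^ (i - Suc j) * h i) * f"
        using that by (simp add: Suc_diff_Suc[symmetric])
      then show ?thesis
        using q'.mult[OF f(1)] pols_mult[OF pols_power[OF fV] h] by metis
    qed
    ultimately have "h j \<in> q'"
      using q'.diff q'.sum by (metis (no_types, lifting) add_diff_cancel_right')
    then show ?case
      using F(3) unfolding alg_indep_def h_def by blast
  qed
  show "\<forall>\<alpha>\<in>box (insert f F) D. c \<alpha> = 0"
    using zero unfolding box_def PiE_insert_eq by auto
qed

text \<open>Ensures that an element adjoined along a chain of primes is new, so that the cardinality
  really grows.\<close>

lemma alg_indep_not_in:
  assumes "polynomial_prime V q" "finite F" "alg_indep q F" "f \<in> F" "F \<subseteq> pols V"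
  shows "f \<notin> q"
proof
  assume "f \<in> q"
  interpret polynomial_prime V q by fact
  define G where "G = F - {f}"
  have F: "F = insert f G" "f \<notin> G" "finite G"
    using assms by (auto simp: G_def)
  \<comment> \<open>Selecting all exponent vectors with \<open>\<alpha> f = 1\<close> gives
    \<open>f\<close> times the sum of all squarefree products over \<open>G\<close>. This multiple
    of \<open>f\<close> lies in \<open>q\<close> although its coefficients are not all zero.\<close>
  define c where "c \<alpha> = (if \<alpha> f = 1 then 1 else 0 :: 'b)" for \<alpha> :: "_ \<Rightarrow> nat"
  have "box_poly c F 2 = f * box_poly (\<lambda>_. 1) G 2"
    unfolding F(1) by (subst box_poly_insert) (auto simp: F c_def numeral_2_eq_2 box_poly_def)
  moreover have "box_poly (\<lambda>_. 1) G 2 \<in> pols V"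
    using assms(5) F by (intro box_poly_pols) auto
  ultimately have "box_poly c F 2 \<in> q"
    using mult[OF \<open>f \<in> q\<close>] by (metis mult.commute)
  moreover have "restrict (\<lambda>_. 1) F \<in> box F 2"
    by (auto simp: box_def)
  ultimately have "c (restrict (\<lambda>_. 1) F) = 0"
    using assms(3) unfolding alg_indep_def by blast
  then show False
    using assms(4) by (simp add: c_def)
qed

section \<open>Counting monomials\<close>

text \<open>The degree is bounded in each variable separately, to match the count of exponent
  vectors in a box.\<close>

definition exponent_bound :: "nat \<Rightarrow> (('v \<Rightarrow>\<^sub>0 nat) \<Rightarrow>\<^sub>0 'k::field) \<Rightarrow> bool" where
  "exponent_bound e f \<longleftrightarrow> (\<forall>m\<in>keys f. \<forall>v. lookup m v \<le> e)"

lemma exponent_bound_mult: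
  assumes "exponent_bound e f" "exponent_bound e' g"
  shows "exponent_bound (e + e') (f * g)"
  unfolding exponent_bound_def
proof (intro ballI allI)
  fix m v
  assume "m \<in> keys (f * g)"
  then obtain a b where "m = a + b" "a \<in> keys f" "b \<in> keys g"
    using keys_mult[of f g] by blast
  then show "lookup m v \<le> e + e'"
    using assms by (auto simp: exponent_bound_def lookup_add intro!: add_mono)
qed

lemma exponent_bound_mono: "exponent_bound e f \<Longrightarrow> e \<le> e' \<Longrightarrow> exponent_bound e' f"
  unfolding exponent_bound_def using order_trans by blast

lemma exponent_bound_one: "exponent_bound 0 1"
  by (simp add: exponent_bound_def)

lemma exponent_bound_power: "exponent_bound e f \<Longrightarrow> exponent_bound (n * e) (f ^ n)"
  by (induction n) (simp_all add: exponent_bound_one exponent_bound_mult)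

lemma exponent_bound_prod:
  "finite F \<Longrightarrow> (\<And>f. f \<in> F \<Longrightarrow> exponent_bound e (g f)) \<Longrightarrow> exponent_bound (card F * e) (prod g F)"
  by (induction F rule: finite_induct) (simp_all add: exponent_bound_one exponent_bound_mult)

lemma exponent_bound_exists:
  assumes "finite F"
  shows "\<exists>e. \<forall>f\<in>F. exponent_bound e f"
proof -
  define L where "L = (\<Union>f\<in>F. \<Union>m\<in>keys f. lookup m ` keys m)"
  have fin: "finite L"
    using assms by (simp add: L_def)
  have "lookup m v \<le> Max (insert 0 L)" if "f \<in> F" "m \<in> keys f" for f m v
  proof (cases "lookup m v = 0")
    case False
    then have "lookup m v \<in> L"
      using that unfolding L_def by (blast intro: in_keys_iff[THEN iffD2])
    then show ?thesis
      using fin by simp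
  qed simp
  then show ?thesis
    unfolding exponent_bound_def by blast
qed

lemma card_bounded_monomials:
  assumes "finite V"
  shows "finite {m. keys m \<subseteq> V \<and> (\<forall>v. lookup m v < N)}" (is "finite ?M")
    and "card {m. keys m \<subseteq> V \<and> (\<forall>v. lookup m v < N)} \<le> N ^ card V"
proof -
  have inj: "inj_on (\<lambda>m. restrict (lookup m) V) ?M"
  proof (rule inj_onI)
    fix m m'
    assume m: "m \<in> ?M" "m' \<in> ?M" "restrict (lookup m) V = restrict (lookup m') V"
    show "m = m'"
    proof (rule poly_mapping_eqI)
      fix v
      show "lookup m v = lookup m' v"
        using m restrict_apply'[of v V "lookup m"] restrict_apply'[of v V "lookup m'"]
        by (cases "v \<in> V") (auto simp: in_keys_iff subset_iff, metis neq0_conv)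
    qed
  qed
  have sub: "(\<lambda>m. restrict (lookup m) V) ` ?M \<subseteq> box V N"
    by (auto simp: box_def)
  show "finite ?M"
    using inj_on_finite[OF inj sub finite_box[OF assms]] .
  show "card ?M \<le> N ^ card V"
    using card_inj_on_le[OF inj sub finite_box[OF assms]] by (simp add: card_box[OF assms])
qed

text \<open>A dimension count. There are \<open>D ^ card F\<close> products of members of
  \<open>F\<close> with exponents below \<open>D\<close>, but the monomials occurring in them number
  at most a constant times \<open>D ^ card V\<close>. If \<open>F\<close> were larger than
  \<open>V\<close>, a large \<open>D\<close> would force a linear dependency.\<close>

lemma alg_indep_card_le:
  assumes V: "finite V" and F: "finite F" "F \<subseteq> pols V" "alg_indep q F" and "0 \<in> q"
  shows "card F \<le> card V"
proof (rule ccontr)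
  assume "\<not> ?thesis"
  then have less: "card V < card F"
    by simp
  obtain e where e: "\<And>f. f \<in> F \<Longrightarrow> exponent_bound e f"
    using exponent_bound_exists[OF F(1)] by blast
  \<comment> \<open>\<open>s\<close> exceeds \<open>card F * e\<close>, so all exponents that occur
    stay below \<open>N = D * s\<close>. \<open>D\<close> exceeds \<open>s ^ card V\<close>, so
    \<open>N ^ card V = D ^ card V * s ^ card V\<close> is less than
    \<open>D ^ Suc (card V)\<close>.\<close>
  define s where "s = Suc (card F * e)"
  define D where "D = Suc (s ^ card V)"
  define N where "N = D * s"
  define M where "M = {m. keys m \<subseteq> V \<and> (\<forall>v. lookup m v < N)}"
  define g where "g \<alpha> = (\<Prod>f\<in>F. f ^ \<alpha> f)" for \<alpha> :: "_ \<Rightarrow> nat"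
  have g: "keys (g \<alpha>) \<subseteq> M" if \<alpha>: "\<alpha> \<in> box F D" for \<alpha>
  proof
    fix m
    assume m: "m \<in> keys (g \<alpha>)"
    have "exponent_bound (card F * (D * e)) (g \<alpha>)"
      unfolding g_def using e box_less[OF \<alpha>]
      by (intro exponent_bound_prod[OF F(1)] exponent_bound_mono[OF exponent_bound_power mult_le_mono1])
         (auto intro: less_imp_le)
    moreover have "card F * (D * e) < N"
      by (simp add: N_def s_def D_def algebra_simps)
    ultimately have "lookup m v < N" for v
      using m by (auto simp: exponent_bound_def intro: le_less_trans)
    moreover have "g \<alpha> \<in> pols V"
      unfolding g_def using F(2) by (intro pols_prod pols_power) auto
    ultimately show "m \<in> M"
      using m by (simp add: M_def pols_def)
  qed
  have "card M \<le> N ^ card V"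
    unfolding M_def by (rule card_bounded_monomials[OF V])
  also have "\<dots> = D ^ card V * s ^ card V"
    by (simp add: N_def power_mult_distrib)
  also have "\<dots> < D ^ card V * D"
    by (simp add: D_def)
  also have "\<dots> = D ^ Suc (card V)"
    by simp
  also have "\<dots> \<le> D ^ card F"
    using less by (intro power_increasing) (auto simp: D_def)
  finally have "card M < card (box F D)"
    using F(1) by (simp add: card_box)
  moreover have "finite M"
    unfolding M_def by (rule card_bounded_monomials[OF V])
  ultimately have "\<exists>c. (\<exists>\<alpha>\<in>box F D. c \<alpha> \<noteq> 0) \<and>
      (\<forall>m\<in>M. (\<Sum>\<alpha>\<in>box F D. lookup (g \<alpha>) m * c \<alpha>) = 0)"
    by (intro nontrivial_solution finite_box F(1))
  then obtain c where c: "\<exists>\<alpha>\<in>box F D. c \<alpha> \<noteq> 0"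
    "\<And>m. m \<in> M \<Longrightarrow> (\<Sum>\<alpha>\<in>box F D. lookup (g \<alpha>) m * c \<alpha>) = 0"
    by auto
  have "box_poly c F D = 0"
  proof (rule poly_mapping_eqI)
    fix m
    have "lookup (single 0 a * h) m = a * lookup h m" for a and h :: "('a \<Rightarrow>\<^sub>0 nat) \<Rightarrow>\<^sub>0 'b"
      by (induction h rule: mpoly_induct)
         (auto simp: mult_single lookup_single when_def distrib_left lookup_add)
    then have "lookup (box_poly c F D) m = (\<Sum>\<alpha>\<in>box F D. lookup (g \<alpha>) m * c \<alpha>)"
      by (simp add: box_poly_def lookup_sum g_def mult.commute[of _ "c _"])
    also have "\<dots> = 0"
    proof (cases "m \<in> M")
      case False
      then have "lookup (g \<alpha>) m = 0" if "\<alpha> \<in> box F D" for \<alpha>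
        using g[OF that] by (auto simp: in_keys_iff)
      then show ?thesis
        by simp
    qed (rule c(2))
    finally show "lookup (box_poly c F D) m = lookup 0 m"
      by simp
  qed
  then show False
    using F(3) c(1) \<open>0 \<in> q\<close> unfolding alg_indep_def by metis
qed

lemma prime_height_le:
  assumes V: "finite V" and F: "finite F" "F \<subseteq> pols V" "alg_indep p F"
  shows "prime_height (polynomial_ring V) p \<le> enat (card V - card F)"
proof -
  have "n \<le> card V - card F"
    if q: "q n = p" "\<And>i. i \<le> n \<Longrightarrow> polynomial_prime V (q i)" "\<And>i. i < n \<Longrightarrow> q i \<subset> q (Suc i)" for n q
  proof -
    \<comment> \<open>The index \<open>n - j\<close> walks down the chain from \<open>p\<close>;
      each strict inclusion supplies an element of the larger prime outside the smaller one, to be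
      adjoined.\<close>
    have "\<exists>G. finite G \<and> G \<subseteq> pols V \<and> alg_indep (q (n - j)) G \<and> card G = card F + j" if "j \<le> n" for j
      using that
    proof (induction j)
      case 0
      then show ?case
        using F q(1) by auto
    next
      case (Suc j)
      then obtain G where G: "finite G" "G \<subseteq> pols V" "alg_indep (q (n - j)) G" "card G = card F + j"
        by auto
      have eq: "n - j = Suc (n - Suc j)"
        using Suc.prems by simp
      then have "q (n - Suc j) \<subset> q (n - j)"
        using q(3)[of "n - Suc j"] Suc.prems by simp
      then obtain f where f: "f \<in> q (n - j)" "f \<notin> q (n - Suc j)" "q (n - Suc j) \<subseteq> q (n - j)"
        by blast
      have prime: "polynomial_prime V (q (n - j))" "polynomial_prime V (q (n - Suc j))"
        by (auto intro: q(2))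
      have "f \<notin> G"
        using alg_indep_not_in[OF prime(1) G(1,3) _ G(2)] f(1) by blast
      moreover have "f \<in> pols V"
        using f(1) polynomial_prime.subset[OF prime(1)] by blast
      ultimately show ?case
        using alg_indep_insert[OF prime(2,1) f(3,1,2) G(1-3)] G
        by (intro exI[of _ "insert f G"]) auto
    qed
    from this[of n] obtain G where G: "finite G" "G \<subseteq> pols V" "alg_indep (q 0) G" "card G = card F + n"
      by auto
    then have "card F + n \<le> card V"
      using alg_indep_card_le[OF V G(1-3)] polynomial_prime.zero[OF q(2)[of 0]] by simp
    then show ?thesis
      by simp
  qed
  then show ?thesis
    unfolding prime_height_def primeideal_polynomial_ring_iff by (intro Sup_least) auto
qed

section \<open>Toric primes and binomial relations\<close>

lemma variable_power: "single (single v (Suc 0)) 1 ^ k = (single (single v k) 1 :: ('v \<Rightarrow>\<^sub>0 nat) \<Rightarrow>\<^sub>0 'k::field)"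
  by (induction k) (auto simp: mult_single single_add[symmetric])

text \<open>The kernel of the map sending the monomial \<open>m\<close> to the Laurent monomial with
  exponent \<open>h m\<close>.\<close>

definition toric_ideal :: "(('v \<Rightarrow>\<^sub>0 nat) \<Rightarrow> ('w \<Rightarrow>\<^sub>0 int)) \<Rightarrow> 'v set \<Rightarrow> (('v \<Rightarrow>\<^sub>0 nat) \<Rightarrow>\<^sub>0 'k::field) set" where
  "toric_ideal h V = {f \<in> pols V. map_exponents h f = 0}"

text \<open>The target has no zero divisors: integer exponent vectors over a linearly ordered index
  type form a linearly ordered group. For points the order is the lexicographic one.\<close>

lemma polynomial_prime_toric_ideal:
  fixes h :: "('v \<Rightarrow>\<^sub>0 nat) \<Rightarrow> ('w::linorder \<Rightarrow>\<^sub>0 int)"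
  assumes h: "\<And>m m'. h (m + m') = h m + h m'"
  shows "polynomial_prime V (toric_ideal h V :: (('v \<Rightarrow>\<^sub>0 nat) \<Rightarrow>\<^sub>0 'k::field) set)"
proof
  have "map_exponents h (single 0 1 :: ('v \<Rightarrow>\<^sub>0 nat) \<Rightarrow>\<^sub>0 'k) \<noteq> 0"
    unfolding map_exponents_simps by (metis lookup_single_eq lookup_zero zero_neq_one)
  then show "(1 :: ('v \<Rightarrow>\<^sub>0 nat) \<Rightarrow>\<^sub>0 'k) \<notin> toric_ideal h V"
    by (simp add: toric_ideal_def)
qed (auto simp: toric_ideal_def map_exponents_mult[of h, OF h] pols_add pols_mult)

text \<open>No two monomials in \<open>B\<close> are merged by \<open>h\<close>, so the coefficients
  of a polynomial can be read off its image.\<close>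

lemma toric_ideal_Int_pols:
  assumes "inj_on h {m. keys m \<subseteq> B}"
  shows "toric_ideal h V \<inter> pols B \<subseteq> {0}"
proof
  fix f
  assume f: "f \<in> toric_ideal h V \<inter> pols B"
  have "lookup (map_exponents h f) (h m) = lookup f m" if m: "keys m \<subseteq> B" for m
  proof -
    have "lookup (map_exponents h f) (h m) = (\<Sum>m'\<in>keys f. lookup f m' when m' = m)"
      unfolding map_exponents_def linear_ext_def lookup_sum lookup_single
      using f m inj_on_eq_iff[OF assms] by (intro sum.cong) (auto simp: pols_def when_def)
    also have "\<dots> = lookup f m"
      by (auto simp: when_def in_keys_iff)
    finally show ?thesis .
  qed
  then have "lookup f m = 0" for m
    using f by (cases "keys m \<subseteq> B") (auto simp: toric_ideal_def pols_def in_keys_iff)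
  then show "f \<in> {0}"
    by (simp add: poly_mapping_eqI)
qed

lemma alg_indep_variables:
  fixes p :: "(('v \<Rightarrow>\<^sub>0 nat) \<Rightarrow>\<^sub>0 'k::field) set"
  assumes "finite B" "p \<inter> pols B \<subseteq> {0}"
  shows "alg_indep p ((\<lambda>b. single (single b 1) 1) ` B)"
  unfolding alg_indep_def
proof (intro allI impI)
  let ?x = "\<lambda>b. single (single b 1) 1 :: ('v \<Rightarrow>\<^sub>0 nat) \<Rightarrow>\<^sub>0 'k"
  fix c D
  assume "box_poly c (?x ` B) D \<in> p"
  moreover have "box_poly c (?x ` B) D \<in> pols B"
    by (intro box_poly_pols image_subsetI pols_single) auto
  ultimately have zero: "box_poly c (?x ` B) D = 0"
    using assms(2) by blast
  \<comment> \<open>Independence is stated for a set of polynomials, so distinct members of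
    \<open>B\<close> must give distinct variables before products over the image can be
    reindexed.\<close>
  have inj: "inj ?x"
    by (intro injI) (metis lookup_single_eq lookup_single_not_eq one_neq_zero)
  define mon where "mon \<alpha> = (\<Sum>b\<in>B. single b (\<alpha> (?x b)))" for \<alpha> :: "_ \<Rightarrow> nat"
  have "(\<Prod>b\<in>B'. ?x b ^ \<alpha> (?x b)) = single (\<Sum>b\<in>B'. single b (\<alpha> (?x b))) 1" for \<alpha> B'
    by (induction B' rule: infinite_finite_induct) (auto simp: variable_power mult_single)
  then have "(\<Prod>f\<in>?x ` B. f ^ \<alpha> f) = single (mon \<alpha>) 1" for \<alpha>
    using inj by (simp add: prod.reindex inj_on_def mon_def)
  then have sum: "box_poly c (?x ` B) D = (\<Sum>\<alpha>\<in>box (?x ` B) D. single (mon \<alpha>) (c \<alpha>))"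
    by (simp add: box_poly_def mult_single)
  have mon: "lookup (mon \<alpha>) b = \<alpha> (?x b)" if "b \<in> B" for \<alpha> b
    using that assms(1) by (simp add: mon_def lookup_sum lookup_single when_def)
  have "inj_on mon (box (?x ` B) D)"
  proof (rule inj_onI)
    fix \<alpha> \<beta>
    assume *: "\<alpha> \<in> box (?x ` B) D" "\<beta> \<in> box (?x ` B) D" "mon \<alpha> = mon \<beta>"
    show "\<alpha> = \<beta>"
    proof (rule PiE_ext)
      show "\<alpha> \<in> ?x ` B \<rightarrow>\<^sub>E {..<D}" "\<beta> \<in> ?x ` B \<rightarrow>\<^sub>E {..<D}"
        using * by (simp_all add: box_def)
      show "\<alpha> f = \<beta> f" if "f \<in> ?x ` B" for f
        using that mon[of _ \<alpha>] mon[of _ \<beta>] *(3) by auto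
    qed
  qed
  then have "lookup (box_poly c (?x ` B) D) (mon \<alpha>) = c \<alpha>" if "\<alpha> \<in> box (?x ` B) D" for \<alpha>
    unfolding sum lookup_sum lookup_single when_def
    using that assms(1) finite_box[of "?x ` B" D]
    by (subst sum.cong[where h = "\<lambda>\<beta>. if \<beta> = \<alpha> then c \<alpha> else 0"]) (auto simp: inj_on_eq_iff)
  then show "\<forall>\<alpha>\<in>box (?x ` B) D. c \<alpha> = 0"
    unfolding zero by simp
qed

section \<open>Monomial congruences modulo a prime\<close>

text \<open>\<open>U\<close> is meant to consist of variables outside \<open>p\<close>, so that
  common monomial factors can be cancelled.\<close>

definition congruent_monomials ::
  "(('v \<Rightarrow>\<^sub>0 nat) \<Rightarrow>\<^sub>0 'k::field) set \<Rightarrow> 'v set \<Rightarrow> ('v \<Rightarrow>\<^sub>0 nat) \<Rightarrow> ('v \<Rightarrow>\<^sub>0 nat) \<Rightarrow> bool" where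
  "congruent_monomials p U \<alpha> \<beta> \<longleftrightarrow> keys \<alpha> \<subseteq> U \<and> keys \<beta> \<subseteq> U \<and> single \<alpha> 1 - single \<beta> 1 \<in> p"

context polynomial_prime
begin

lemma congruent_monomials_add:
  assumes "U \<subseteq> V" "congruent_monomials p U \<alpha> \<beta>" "congruent_monomials p U \<gamma> \<delta>"
  shows "congruent_monomials p U (\<alpha> + \<gamma>) (\<beta> + \<delta>)"
proof -
  have "single \<gamma> 1 * (single \<alpha> 1 - single \<beta> 1) + single \<beta> 1 * (single \<gamma> 1 - single \<delta> 1) \<in> p"
    using assms by (intro add mult pols_single) (auto simp: congruent_monomials_def)
  then have "single (\<alpha> + \<gamma>) 1 - single (\<beta> + \<delta>) 1 \<in> p"
    by (simp add: algebra_simps mult_single)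
  then show ?thesis
    using assms keys_add[of \<alpha> \<gamma>] keys_add[of \<beta> \<delta>] unfolding congruent_monomials_def by blast
qed

lemma congruent_monomials_sym: "congruent_monomials p U \<alpha> \<beta> \<Longrightarrow> congruent_monomials p U \<beta> \<alpha>"
  using uminus[of "single \<alpha> 1 - single \<beta> 1"] by (simp add: congruent_monomials_def)

lemma congruent_monomials_sum:
  assumes "U \<subseteq> V" "\<And>i. i \<in> I \<Longrightarrow> congruent_monomials p U (\<alpha> i) (\<beta> i)"
  shows "congruent_monomials p U (sum \<alpha> I) (sum \<beta> I)"
  using assms(2)
proof (induction I rule: infinite_finite_induct)
  case (insert i I)
  then show ?case
    using congruent_monomials_add[OF assms(1)] by simp
qed (auto simp: congruent_monomials_def zero)

lemma monomial_notin:
  assumes "finite V" "keys m \<subseteq> V" "\<And>v. v \<in> keys m \<Longrightarrow> single (single v 1) 1 \<notin> p"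
  shows "single m 1 \<notin> p"
proof -
  have "single (\<Sum>v\<in>W. single v (lookup m v)) 1 \<notin> p" if "finite W" "W \<subseteq> keys m" for W
    using that
  proof (induction W rule: finite_induct)
    case (insert v W)
    have "single (single v 1) 1 \<in> pols V" "single (single v 1) 1 \<notin> p"
      using insert.prems assms(2,3) by (auto intro!: pols_single)
    then have "single (single v (lookup m v)) 1 \<notin> p"
      using power[of "single (single v 1) 1" "lookup m v"] by (simp add: variable_power)
    moreover have "keys (\<Sum>v\<in>W. single v (lookup m v)) \<subseteq> V"
      using keys_sum[of "\<lambda>v. single v (lookup m v)" W] insert.prems assms(2)
      by (force split: if_splits)
    moreover have "keys (single v (lookup m v)) \<subseteq> V"
      using insert.prems assms(2) by auto
    ultimately have "single (single v (lookup m v)) 1 * single (\<Sum>v\<in>W. single v (lookup m v)) 1 \<notin> p"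
      using prime pols_single insert by (metis insert_subset)
    then show ?case
      using insert.hyps by (simp add: mult_single)
  qed (simp add: one)
  moreover have "(\<Sum>v\<in>keys m. single v (lookup m v)) = m"
    by (rule poly_mapping_eqI) (auto simp: lookup_sum lookup_single when_def in_keys_iff)
  ultimately show ?thesis
    by (metis finite_keys subset_refl)
qed

lemma congruent_monomials_cancel:
  assumes "finite V" "U \<subseteq> V" "\<And>v. v \<in> U \<Longrightarrow> single (single v 1) 1 \<notin> p"
    and \<alpha>\<beta>: "congruent_monomials p U \<alpha> \<beta>"
  shows "congruent_monomials p U (\<alpha> - \<beta>) (\<beta> - \<alpha>)"
proof -
  have sub: "keys (\<alpha> - \<gamma>) \<subseteq> keys \<alpha>" for \<alpha> \<gamma> :: "'v \<Rightarrow>\<^sub>0 nat"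
    by (auto simp: in_keys_iff lookup_minus)
  \<comment> \<open>The pointwise minimum of \<open>\<alpha>\<close> and \<open>\<beta>\<close>,
    that is, the exponent of the greatest common divisor.\<close>
  define \<gamma> where "\<gamma> = \<alpha> - (\<alpha> - \<beta>)"
  have split: "\<alpha> = \<gamma> + (\<alpha> - \<beta>)" "\<beta> = \<gamma> + (\<beta> - \<alpha>)"
    by (rule poly_mapping_eqI, simp add: \<gamma>_def lookup_add lookup_minus)+
  have U: "keys \<alpha> \<subseteq> U" "keys \<beta> \<subseteq> U" "keys \<gamma> \<subseteq> U"
    using \<alpha>\<beta> sub[of \<alpha> "\<alpha> - \<beta>"] by (auto simp: congruent_monomials_def \<gamma>_def)
  have "single \<gamma> (1 :: 'k) * (single (\<alpha> - \<beta>) 1 - single (\<beta> - \<alpha>) 1) =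
      single (\<gamma> + (\<alpha> - \<beta>)) 1 - single (\<gamma> + (\<beta> - \<alpha>)) 1"
    by (simp add: right_diff_distrib mult_single)
  also have "\<dots> = single \<alpha> 1 - single \<beta> 1"
    by (simp only: split[symmetric])
  finally have "single \<gamma> (1 :: 'k) * (single (\<alpha> - \<beta>) 1 - single (\<beta> - \<alpha>) 1) \<in> p"
    using \<alpha>\<beta> by (simp add: congruent_monomials_def)
  moreover have "single \<gamma> 1 \<notin> p"
    by (rule monomial_notin[OF assms(1) subset_trans[OF U(3) assms(2)] assms(3)[OF subsetD[OF U(3)]]])
  moreover have "single \<gamma> 1 \<in> pols V" "single (\<alpha> - \<beta>) 1 - single (\<beta> - \<alpha>) 1 \<in> pols V"
    using U assms(2) sub by (auto intro!: pols_diff pols_single) blast+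
  ultimately have "single (\<alpha> - \<beta>) 1 - single (\<beta> - \<alpha>) 1 \<in> p"
    using prime by blast
  then show ?thesis
    using U sub unfolding congruent_monomials_def by blast
qed


text \<open>If \<open>E\<close> were larger than \<open>U - T\<close>, some integer combination of
  the vectors \<alpha> i - \<beta> i would vanish on \<open>U - T\<close>. Multiplying the
  congruences accordingly and cancelling leaves a binomial of \<open>p\<close> in the variables
  \<open>T\<close>; it must be zero, so the combination vanishes everywhere, against
  \<open>indep\<close>.\<close>

lemma card_indep_variables_le:
  assumes V: "finite V" and T: "T \<subseteq> V" "p \<inter> pols T \<subseteq> {0}"
    and U: "U = {v \<in> V. single (single v 1) 1 \<notin> p}"
    and E: "finite E" "\<And>i. i \<in> E \<Longrightarrow> congruent_monomials p U (\<alpha> i) (\<beta> i)"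
    and indep: "\<And>c. (\<And>v. v \<in> U \<Longrightarrow> (\<Sum>i\<in>E. (int (lookup (\<alpha> i) v) - int (lookup (\<beta> i) v)) * c i) = 0) \<Longrightarrow>
      \<forall>i\<in>E. c i = 0"
  shows "card T + card E \<le> card U"
proof (rule ccontr)
  assume less: "\<not> ?thesis"
  have "single (single v 1) 1 \<notin> p" if "v \<in> T" for v
  proof
    assume "single (single v 1) 1 \<in> p"
    moreover have "single (single v 1) 1 \<in> pols T"
      using that by (auto intro: pols_single)
    ultimately have "single (single v 1) 1 = (0 :: ('v \<Rightarrow>\<^sub>0 nat) \<Rightarrow>\<^sub>0 'k)"
      using T(2) by blast
    then show False
      by (metis lookup_single_eq lookup_zero zero_neq_one)
  qed
  then have "T \<subseteq> U"
    using T(1) U by blast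
  moreover have fin: "finite U"
    using U V by simp
  ultimately have "card (U - T) < card E"
    using less card_mono[of U T] by (simp add: card_Diff_subset finite_subset)
  then have "\<exists>c. (\<exists>i\<in>E. c i \<noteq> 0) \<and>
      (\<forall>v\<in>U - T. (\<Sum>i\<in>E. (int (lookup (\<alpha> i) v) - int (lookup (\<beta> i) v)) * c i) = 0)"
    using fin E(1) by (intro nontrivial_solution) auto
  then obtain c where c: "\<exists>i\<in>E. c i \<noteq> 0"
    "\<And>v. v \<in> U - T \<Longrightarrow> (\<Sum>i\<in>E. (int (lookup (\<alpha> i) v) - int (lookup (\<beta> i) v)) * c i) = 0"
    by auto
  \<comment> \<open>A negative coefficient exchanges the two sides of its congruence, which keeps
    all exponents natural numbers; for each \<open>i\<close> at most one of the two inner sums is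
    nonempty.\<close>
  define X where "X \<gamma> \<delta> = (\<Sum>i\<in>E. (\<Sum>_<nat (c i). \<gamma> i) + (\<Sum>_<nat (- c i). \<delta> i))"
    for \<gamma> \<delta> :: "_ \<Rightarrow> 'v \<Rightarrow>\<^sub>0 nat"
  have "U \<subseteq> V"
    using U by blast
  have cong: "congruent_monomials p U (X \<alpha> \<beta>) (X \<beta> \<alpha>)"
    unfolding X_def using E(2) congruent_monomials_sym
    by (intro congruent_monomials_sum congruent_monomials_add \<open>U \<subseteq> V\<close>) auto
  have nat_c: "int (nat (c i)) = c i + int (nat (- c i))" for i
    by simp
  have diff: "int (lookup (X \<alpha> \<beta>) v) - int (lookup (X \<beta> \<alpha>) v) =
      (\<Sum>i\<in>E. (int (lookup (\<alpha> i) v) - int (lookup (\<beta> i) v)) * c i)" for v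
    unfolding X_def lookup_sum lookup_add of_nat_sum sum_subtractf[symmetric]
    by (intro sum.cong refl) (simp add: nat_c algebra_simps del: int_nat_eq)
  have eqT: "lookup (X \<alpha> \<beta>) v = lookup (X \<beta> \<alpha>) v" if "v \<notin> T" for v
  proof (cases "v \<in> U")
    case True
    then show ?thesis
      using diff[of v] c(2)[of v] that by simp
  next
    case False
    then have "v \<notin> keys (X \<alpha> \<beta>)" "v \<notin> keys (X \<beta> \<alpha>)"
      using cong by (auto simp: congruent_monomials_def)
    then show ?thesis
      by (simp add: in_keys_iff)
  qed
  have "keys (X \<alpha> \<beta> - X \<beta> \<alpha>) \<subseteq> T" "keys (X \<beta> \<alpha> - X \<alpha> \<beta>) \<subseteq> T"
    using eqT by (auto simp: in_keys_iff lookup_minus) (metis order_refl)+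
  then have "single (X \<alpha> \<beta> - X \<beta> \<alpha>) 1 - single (X \<beta> \<alpha> - X \<alpha> \<beta>) 1 \<in> pols T"
    by (intro pols_diff pols_single)
  moreover have "single (X \<alpha> \<beta> - X \<beta> \<alpha>) 1 - single (X \<beta> \<alpha> - X \<alpha> \<beta>) 1 \<in> p"
    using congruent_monomials_cancel[OF V \<open>U \<subseteq> V\<close> _ cong] U by (auto simp: congruent_monomials_def)
  ultimately have "single (X \<alpha> \<beta> - X \<beta> \<alpha>) 1 = (single (X \<beta> \<alpha> - X \<alpha> \<beta>) 1 :: ('v \<Rightarrow>\<^sub>0 nat) \<Rightarrow>\<^sub>0 'k)"
    using T(2) by auto
  then have eq: "X \<alpha> \<beta> - X \<beta> \<alpha> = X \<beta> \<alpha> - X \<alpha> \<beta>"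
    by (metis lookup_single_eq lookup_single_not_eq one_neq_zero)
  have "lookup (X \<alpha> \<beta>) v = lookup (X \<beta> \<alpha>) v" for v
    using arg_cong[OF eq, of "\<lambda>m. lookup m v"] by (simp add: lookup_minus)
  then have "(\<Sum>i\<in>E. (int (lookup (\<alpha> i) v) - int (lookup (\<beta> i) v)) * c i) = 0" for v
    using diff[of v] by simp
  then show False
    using indep c(1) by blast
qed

end

section \<open>Geometry of closed paths\<close>

lemma mem_cell: "v \<in> cell a \<longleftrightarrow> fst v \<in> {fst a, fst a + 1} \<and> snd v \<in> {snd a, snd a + 1}"
  by (cases v; cases a) (auto simp: cell_def lattice_interval_def)

lemma cell_eq: "cell (x, y) = {(x, y), (x + 1, y), (x, y + 1), (x + 1, y + 1)}"
  by (auto simp: mem_cell)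

lemma cell_inj: "cell a = cell b \<longleftrightarrow> a = b"
proof
  assume eq: "cell a = cell b"
  have "a \<in> cell b" "b \<in> cell a"
    using eq by (metis insertI1 mem_cell)+
  then show "a = b"
    by (auto simp: mem_cell prod_eq_iff)
qed simp

lemma cell_subset_interval:
  assumes "proper_interval a b"
  shows "cell c \<subseteq> lattice_interval a b \<longleftrightarrow>
    fst a \<le> fst c \<and> fst c < fst b \<and> snd a \<le> snd c \<and> snd c < snd b"
  by (cases c) (auto simp: cell_eq lattice_interval_def)

definition adjacent :: "point set \<Rightarrow> point set \<Rightarrow> bool" where
  "adjacent C D \<longleftrightarrow> (\<exists>x y. (C = cell (x, y) \<and> D = cell (x + 1, y)) \<or> (D = cell (x, y) \<and> C = cell (x + 1, y)) \<or>
     (C = cell (x, y) \<and> D = cell (x, y + 1)) \<or> (D = cell (x, y) \<and> C = cell (x, y + 1)))"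

lemma adjacent_cases [consumes 1, case_names left right below above]:
  assumes "adjacent C D"
  obtains x y where "C = cell (x, y)" "D = cell (x + 1, y)"
  | x y where "D = cell (x, y)" "C = cell (x + 1, y)"
  | x y where "C = cell (x, y)" "D = cell (x, y + 1)"
  | x y where "D = cell (x, y)" "C = cell (x, y + 1)"
  using assms unfolding adjacent_def by blast

lemma adjacent_sym: "adjacent C D \<Longrightarrow> adjacent D C"
  unfolding adjacent_def by blast

lemma adjacent_if_common_edge:
  assumes "C \<in> range cell" "D \<in> range cell" "C \<noteq> D" "C \<inter> D \<in> cell_edges C"
  shows "adjacent C D"
proof -
  obtain x y u v where C: "C = cell (x, y)" and D: "D = cell (u, v)"
    using assms(1,2) by auto
  have mem: "(p, q) \<in> C \<inter> D \<longleftrightarrow> p \<in> {x, x + 1} \<inter> {u, u + 1} \<and> q \<in> {y, y + 1} \<inter> {v, v + 1}" for p q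
    by (auto simp: C D mem_cell)
  have ne: "\<not> (u = x \<and> v = y)"
    using assms(3) by (auto simp: C D)
  have "C \<inter> D \<in> {{(x, y), (x + 1, y)}, {(x, y + 1), (x + 1, y + 1)},
      {(x, y), (x, y + 1)}, {(x + 1, y), (x + 1, y + 1)}}"
    using assms(4) by (auto simp: cell_edges_def C cell_inj)
  then consider "C \<inter> D = {(x, y), (x + 1, y)}" | "C \<inter> D = {(x, y + 1), (x + 1, y + 1)}"
    | "C \<inter> D = {(x, y), (x, y + 1)}" | "C \<inter> D = {(x + 1, y), (x + 1, y + 1)}"
    by blast
  then have "(u = x + 1 \<and> v = y) \<or> (x = u + 1 \<and> v = y) \<or> (u = x \<and> v = y + 1) \<or> (u = x \<and> y = v + 1)"
  proof cases
    case 1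
    show ?thesis
      using mem[of x y, unfolded 1] mem[of "x + 1" y, unfolded 1] mem[of x "y + 1", unfolded 1] ne
      by (simp; presburger)
  next
    case 2
    show ?thesis
      using mem[of x y, unfolded 2] mem[of "x + 1" "y + 1", unfolded 2] mem[of x "y + 1", unfolded 2] ne
      by (simp; presburger)
  next
    case 3
    show ?thesis
      using mem[of x y, unfolded 3] mem[of "x + 1" y, unfolded 3] mem[of x "y + 1", unfolded 3] ne
      by (simp; presburger)
  next
    case 4
    show ?thesis
      using mem[of x y, unfolded 4] mem[of "x + 1" y, unfolded 4] mem[of "x + 1" "y + 1", unfolded 4] ne
      by (simp; presburger)
  qed
  then show ?thesis
    unfolding adjacent_def C D by blast
qed

lemma card_adjacent_diff: "adjacent C D \<Longrightarrow> card (C - D) = 2"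
  by (induction rule: adjacent_cases) (auto simp: cell_eq insert_Diff_if)

text \<open>Two distinct neighbours of \<open>B\<close> are either opposite and disjoint, or meet in
  a single corner of \<open>B\<close>. In both cases the whole edge shared by \<open>B\<close> and
  \<open>C\<close> cannot lie in \<open>A\<close>.\<close>

lemma adjacent_adjacent:
  assumes "adjacent A B" "adjacent B C" "A \<noteq> C"
  shows "A \<inter> C \<subseteq> B" "\<not> B \<inter> C \<subseteq> A"
proof -
  obtain x y where B: "B = cell (x, y)"
    using assms(1) by (auto simp: adjacent_def)
  have nbr: "\<exists>z\<in>{(x + 1, y), (x - 1, y), (x, y + 1), (x, y - 1)}. D = cell z" if "adjacent B D" for D
    using that unfolding adjacent_def B cell_inj by fastforce
  obtain a where a: "A = cell a" "a \<in> {(x + 1, y), (x - 1, y), (x, y + 1), (x, y - 1)}"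
    using nbr[OF adjacent_sym[OF assms(1)]] by auto
  obtain c where c: "C = cell c" "c \<in> {(x + 1, y), (x - 1, y), (x, y + 1), (x, y - 1)}"
    using nbr[OF assms(2)] by auto
  have "a \<noteq> c"
    using a(1) c(1) assms(3) by auto
  show "A \<inter> C \<subseteq> B"
  proof
    fix v
    assume "v \<in> A \<inter> C"
    then show "v \<in> B"
      using a(2) c(2) \<open>a \<noteq> c\<close> unfolding a(1) c(1) B
      by (elim insertE emptyE; simp add: mem_cell; linarith)
  qed
  show "\<not> B \<inter> C \<subseteq> A"
  proof
    assume "B \<inter> C \<subseteq> A"
    then have "\<forall>v\<in>cell (x, y). v \<in> cell c \<longrightarrow> v \<in> cell a"
      unfolding a(1) c(1) B by blast
    then show False
      unfolding cell_eq[of x y] using a(2) c(2) \<open>a \<noteq> c\<close>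
      by (elim insertE emptyE; simp add: mem_cell)
  qed
qed

section \<open>Inner intervals whose corners avoid a set of vertices\<close>

text \<open>What the inner minors in a prime impose on the set \<open>Z\<close> of vertices whose
  variables lie in it: one monomial of a minor is in the prime exactly when the other is.\<close>

definition binomial_closed :: "point set set \<Rightarrow> point set \<Rightarrow> bool" where
  "binomial_closed P Z \<longleftrightarrow> (\<forall>a b. inner_interval P a b \<longrightarrow>
     (a \<in> Z \<or> b \<in> Z \<longleftrightarrow> (fst a, snd b) \<in> Z \<or> (fst b, snd a) \<in> Z))"

definition corners :: "point \<Rightarrow> point \<Rightarrow> point set" where
  "corners a b = {a, b, (fst a, snd b), (fst b, snd a)}"

lemma inner_intervalI:
  assumes "proper_interval a b"
    "\<And>x y. fst a \<le> x \<Longrightarrow> x < fst b \<Longrightarrow> snd a \<le> y \<Longrightarrow> y < snd b \<Longrightarrow> cell (x, y) \<in> P"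
  shows "inner_interval P a b"
  unfolding inner_interval_def using assms by (auto simp: cell_subset_interval)

lemma inner_interval_cell:
  assumes "cell (x, y) \<in> P"
  shows "inner_interval P (x, y) (x + 1, y + 1)"
proof (rule inner_intervalI)
  fix u v
  assume "fst (x, y) \<le> u" "u < fst (x + 1, y + 1)" "snd (x, y) \<le> v" "v < snd (x + 1, y + 1)"
  then have "(u, v) = (x, y)"
    by simp
  then show "cell (u, v) \<in> P"
    using assms by simp
qed (simp add: proper_interval_def)

lemma inner_interval_horizontal_domino:
  assumes "cell (x, y) \<in> P" "cell (x + 1, y) \<in> P"
  shows "inner_interval P (x, y) (x + 2, y + 1)"
proof (rule inner_intervalI)
  fix u v
  assume "fst (x, y) \<le> u" "u < fst (x + 2, y + 1)" "snd (x, y) \<le> v" "v < snd (x + 2, y + 1)"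
  then have "(u, v) = (x, y) \<or> (u, v) = (x + 1, y)"
    by auto
  then show "cell (u, v) \<in> P"
    using assms by auto
qed (simp add: proper_interval_def)

lemma inner_interval_vertical_domino:
  assumes "cell (x, y) \<in> P" "cell (x, y + 1) \<in> P"
  shows "inner_interval P (x, y) (x + 1, y + 2)"
proof (rule inner_intervalI)
  fix u v
  assume "fst (x, y) \<le> u" "u < fst (x + 1, y + 2)" "snd (x, y) \<le> v" "v < snd (x + 1, y + 2)"
  then have "(u, v) = (x, y) \<or> (u, v) = (x, y + 1)"
    by auto
  then show "cell (u, v) \<in> P"
    using assms by auto
qed (simp add: proper_interval_def)

text \<open>If both vertices of the common edge lie in \<open>Z\<close>, then the far edge of \<open>D\<close> avoids \<open>Z\<close>,
  because otherwise it would be contained in \<open>Z\<close>; so the domino \<open>C \<union> D\<close> can be used.\<close>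

lemma interval_avoiding:
  assumes "adjacent D C" "C \<in> P" "D \<in> P" and closed: "binomial_closed P Z"
    and clean: "(C - D) \<inter> Z = {}" and "\<not> D \<subseteq> Z"
  shows "\<exists>a b. inner_interval P a b \<and> corners a b \<inter> Z = {} \<and> C \<subseteq> lattice_interval a b \<and>
    (\<forall>c. cell c \<subseteq> lattice_interval a b \<longrightarrow> cell c = C \<or> cell c = D \<and> C \<inter> D \<subseteq> Z)"
proof -
  have rel: "a \<in> Z \<or> b \<in> Z \<longleftrightarrow> (fst a, snd b) \<in> Z \<or> (fst b, snd a) \<in> Z" if "inner_interval P a b" for a b
    using closed that unfolding binomial_closed_def by blast
  \<comment> \<open>The candidates are the cell \<open>C\<close> alone and the domino of
    \<open>C\<close> and \<open>D\<close>; the four orientations below differ only in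
    coordinates.\<close>
  have choose: ?thesis
    if "inner_interval P a b" "inner_interval P a' b'" "C \<subseteq> lattice_interval a b" "C \<subseteq> lattice_interval a' b'"
      "\<And>c. cell c \<subseteq> lattice_interval a b \<Longrightarrow> cell c = C"
      "\<And>c. cell c \<subseteq> lattice_interval a' b' \<Longrightarrow> cell c = C \<or> cell c = D"
      "corners a b \<inter> Z = {} \<or> corners a' b' \<inter> Z = {} \<and> C \<inter> D \<subseteq> Z" for a b a' b'
    using that by metis
  show ?thesis
    using assms(1)
  proof (cases rule: adjacent_cases)
    case (left x y)
    have i: "inner_interval P (x + 1, y) (x + 2, y + 1)" "inner_interval P (x, y) (x + 2, y + 1)"
      using inner_interval_cell[of "x + 1" y P] inner_interval_horizontal_domino[of x y P] assms(2,3) left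
      by (simp_all add: add.assoc)
    have proper: "proper_interval (x + 1, y) (x + 2, y + 1)" "proper_interval (x, y) (x + 2, y + 1)"
      by (simp_all add: proper_interval_def)
    note cells = cell_subset_interval[OF proper(1)] cell_subset_interval[OF proper(2)]
    have "(x + 2, y) \<in> C - D" "(x + 2, y + 1) \<in> C - D"
      unfolding left by (simp_all add: mem_cell)
    then have Z: "(x + 2, y) \<notin> Z" "(x + 2, y + 1) \<notin> Z"
      using clean by blast+
    have D: "\<not> {(x, y), (x, y + 1), (x + 1, y), (x + 1, y + 1)} \<subseteq> Z"
      using assms(6) unfolding left cell_eq by (auto simp: add.assoc)
    have "C \<inter> D \<subseteq> {(x + 1, y), (x + 1, y + 1)}"
      unfolding left by (auto simp: cell_eq)
    \<comment> \<open>As the far edge of \<open>C\<close> avoids \<open>Z\<close>, the minor of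
      \<open>C\<close> puts both or neither of the shared vertices into \<open>Z\<close>, and the
      minor of the domino does the same for the far edge of \<open>D\<close>.\<close>
    then have "corners (x + 1, y) (x + 2, y + 1) \<inter> Z = {} \<or> corners (x, y) (x + 2, y + 1) \<inter> Z = {} \<and> C \<inter> D \<subseteq> Z"
      using Z D rel[OF i(1)] rel[OF i(2)] unfolding corners_def by auto
    then show ?thesis
      by (intro choose[OF i]) (auto simp: left cells cell_inj prod_eq_iff)
  next
    case (right x y)
    have i: "inner_interval P (x, y) (x + 1, y + 1)" "inner_interval P (x, y) (x + 2, y + 1)"
      using inner_interval_cell[of x y P] inner_interval_horizontal_domino[of x y P] assms(2,3) right
      by (simp_all add: add.assoc)
    have proper: "proper_interval (x, y) (x + 1, y + 1)" "proper_interval (x, y) (x + 2, y + 1)"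
      by (simp_all add: proper_interval_def)
    note cells = cell_subset_interval[OF proper(1)] cell_subset_interval[OF proper(2)]
    have "(x, y) \<in> C - D" "(x, y + 1) \<in> C - D"
      unfolding right by (simp_all add: mem_cell)
    then have Z: "(x, y) \<notin> Z" "(x, y + 1) \<notin> Z"
      using clean by blast+
    have D: "\<not> {(x + 2, y), (x + 2, y + 1), (x + 1, y), (x + 1, y + 1)} \<subseteq> Z"
      using assms(6) unfolding right cell_eq by (auto simp: add.assoc)
    have "C \<inter> D \<subseteq> {(x + 1, y), (x + 1, y + 1)}"
      unfolding right by (auto simp: cell_eq)
    then have "corners (x, y) (x + 1, y + 1) \<inter> Z = {} \<or> corners (x, y) (x + 2, y + 1) \<inter> Z = {} \<and> C \<inter> D \<subseteq> Z"
      using Z D rel[OF i(1)] rel[OF i(2)] unfolding corners_def by auto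
    then show ?thesis
      by (intro choose[OF i]) (auto simp: right cells cell_inj prod_eq_iff)
  next
    case (below x y)
    have i: "inner_interval P (x, y + 1) (x + 1, y + 2)" "inner_interval P (x, y) (x + 1, y + 2)"
      using inner_interval_cell[of x "y + 1" P] inner_interval_vertical_domino[of x y P] assms(2,3) below
      by (simp_all add: add.assoc)
    have proper: "proper_interval (x, y + 1) (x + 1, y + 2)" "proper_interval (x, y) (x + 1, y + 2)"
      by (simp_all add: proper_interval_def)
    note cells = cell_subset_interval[OF proper(1)] cell_subset_interval[OF proper(2)]
    have "(x, y + 2) \<in> C - D" "(x + 1, y + 2) \<in> C - D"
      unfolding below by (simp_all add: mem_cell)
    then have Z: "(x, y + 2) \<notin> Z" "(x + 1, y + 2) \<notin> Z"
      using clean by blast+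
    have D: "\<not> {(x, y), (x + 1, y), (x, y + 1), (x + 1, y + 1)} \<subseteq> Z"
      using assms(6) unfolding below cell_eq by (auto simp: add.assoc)
    have "C \<inter> D \<subseteq> {(x, y + 1), (x + 1, y + 1)}"
      unfolding below by (auto simp: cell_eq)
    then have "corners (x, y + 1) (x + 1, y + 2) \<inter> Z = {} \<or> corners (x, y) (x + 1, y + 2) \<inter> Z = {} \<and> C \<inter> D \<subseteq> Z"
      using Z D rel[OF i(1)] rel[OF i(2)] unfolding corners_def by auto
    then show ?thesis
      by (intro choose[OF i]) (auto simp: below cells cell_inj prod_eq_iff)
  next
    case (above x y)
    have i: "inner_interval P (x, y) (x + 1, y + 1)" "inner_interval P (x, y) (x + 1, y + 2)"
      using inner_interval_cell[of x y P] inner_interval_vertical_domino[of x y P] assms(2,3) above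
      by (simp_all add: add.assoc)
    have proper: "proper_interval (x, y) (x + 1, y + 1)" "proper_interval (x, y) (x + 1, y + 2)"
      by (simp_all add: proper_interval_def)
    note cells = cell_subset_interval[OF proper(1)] cell_subset_interval[OF proper(2)]
    have "(x, y) \<in> C - D" "(x + 1, y) \<in> C - D"
      unfolding above by (simp_all add: mem_cell)
    then have Z: "(x, y) \<notin> Z" "(x + 1, y) \<notin> Z"
      using clean by blast+
    have D: "\<not> {(x, y + 2), (x + 1, y + 2), (x, y + 1), (x + 1, y + 1)} \<subseteq> Z"
      using assms(6) unfolding above cell_eq by (auto simp: add.assoc)
    have "C \<inter> D \<subseteq> {(x, y + 1), (x + 1, y + 1)}"
      unfolding above by (auto simp: cell_eq)
    then have "corners (x, y) (x + 1, y + 1) \<inter> Z = {} \<or> corners (x, y) (x + 1, y + 2) \<inter> Z = {} \<and> C \<inter> D \<subseteq> Z"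
      using Z D rel[OF i(1)] rel[OF i(2)] unfolding corners_def by auto
    then show ?thesis
      by (intro choose[OF i]) (auto simp: above cells cell_inj prod_eq_iff)
  qed
qed

section \<open>Steps around the cyclic list of cells\<close>

text \<open>The distance condition appears in contrapositive form and in terms of successors only,
  so that no signed residues are needed later.\<close>

locale cyclic_cells =
  fixes P :: "point set set" and A :: "nat \<Rightarrow> point set" and n :: nat
  assumes n_gt: "5 < n"
    and inj: "inj_on A {..<n}"
    and image: "A ` {..<n} = P"
    and adjacent: "\<And>i. i < n \<Longrightarrow> adjacent (A i) (A (Suc i mod n))"
    and meet: "\<And>i j. i < n \<Longrightarrow> j < n \<Longrightarrow> A i \<inter> A j \<noteq> {} \<Longrightarrow>
      j \<in> {i, Suc i mod n, Suc (Suc i mod n) mod n} \<or> i \<in> {Suc j mod n, Suc (Suc j mod n) mod n}"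
begin

definition succ :: "nat \<Rightarrow> nat" where
  "succ i = Suc i mod n"

lemma succ_eq: "i < n \<Longrightarrow> succ i = (if Suc i = n then 0 else Suc i)"
  by (auto simp: succ_def)

lemma succ_less [simp]: "succ i < n"
  using n_gt by (simp add: succ_def)

lemma succ_inject: "i < n \<Longrightarrow> j < n \<Longrightarrow> succ i = succ j \<longleftrightarrow> i = j"
  by (auto simp: succ_eq split: if_splits)

lemma succ_succ_neq: "i < n \<Longrightarrow> succ (succ i) \<noteq> i"
  using n_gt by (auto simp: succ_eq[of i] succ_eq[of "Suc i"] succ_eq[of 0])

lemma A_inject: "i < n \<Longrightarrow> j < n \<Longrightarrow> A i = A j \<longleftrightarrow> i = j"
  using inj by (auto simp: inj_on_def)

lemma adjacent_succ: "i < n \<Longrightarrow> adjacent (A i) (A (succ i))"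
  using adjacent by (simp add: succ_def)

lemma A_in: "i < n \<Longrightarrow> A i \<in> P"
  using image by blast

definition new :: "nat \<Rightarrow> point set" where
  "new i = A (succ i) - A i"

lemma card_new: "i < n \<Longrightarrow> card (new i) = 2"
  unfolding new_def by (rule card_adjacent_diff[OF adjacent_sym[OF adjacent_succ]])

lemma two_steps:
  assumes "i < n"
  shows "A i \<inter> A (succ (succ i)) \<subseteq> A (succ i)" "\<not> A (succ i) \<inter> A (succ (succ i)) \<subseteq> A i"
proof -
  have "A i \<noteq> A (succ (succ i))"
    using succ_succ_neq[OF assms] A_inject[of i "succ (succ i)"] assms by auto
  from adjacent_adjacent[OF adjacent_succ[OF assms] adjacent_succ[OF succ_less] this]
  show "A i \<inter> A (succ (succ i)) \<subseteq> A (succ i)" "\<not> A (succ i) \<inter> A (succ (succ i)) \<subseteq> A i" .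
qed

text \<open>Cells that meet are at most two steps apart. One step apart, the later set removes the
  cell containing the earlier one; two steps apart, the common vertices lie in the middle cell,
  which the later set removes.\<close>

lemma new_disjoint:
  assumes "i < n" "j < n" "i \<noteq> j"
  shows "new i \<inter> new j = {}"
proof -
  have 1: "new i \<inter> new (succ i) = {}" for i
    by (auto simp: new_def)
  have 2: "new i \<inter> new (succ (succ i)) = {}" for i
    using two_steps(1)[of "succ i"] by (auto simp: new_def)
  show ?thesis
  proof (rule ccontr)
    assume "new i \<inter> new j \<noteq> {}"
    then have "A (succ i) \<inter> A (succ j) \<noteq> {}"
      by (auto simp: new_def)
    then have "succ j \<in> {succ i, succ (succ i), succ (succ (succ i))} \<or>
        succ i \<in> {succ (succ j), succ (succ (succ j))}"
      using meet[OF succ_less succ_less, of i j] by (simp add: succ_def)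
    then have "j \<in> {i, succ i, succ (succ i)} \<or> i \<in> {succ j, succ (succ j)}"
      using assms by (simp add: succ_inject)
    then show False
      using assms(3) 1[of i] 2[of i] 1[of j] 2[of j] \<open>new i \<inter> new j \<noteq> {}\<close> by auto
  qed
qed

definition free_steps :: "point set \<Rightarrow> nat set" where
  "free_steps Z = {i. i < n \<and> new i \<inter> Z = {} \<and> \<not> A i \<subseteq> Z}"

text \<open>A step whose two new vertices avoid \<open>Z\<close> but which is not free starts at a cell contained
  in \<open>Z\<close>; then both new vertices of the preceding step lie in \<open>Z\<close>, one more than needed.\<close>

lemma rank_le:
  assumes Z: "finite Z"
  shows "n \<le> card Z + card (free_steps Z)"
proof -
  define E where "E = free_steps Z"
  define E' where "E' = {i. i < n \<and> new i \<inter> Z = {} \<and> A i \<subseteq> Z}"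
  have "(\<Sum>i<n. card (new i \<inter> Z)) = card (\<Union>i<n. new i \<inter> Z)"
    using new_disjoint Z by (subst card_UN_disjoint) auto
  also have "\<dots> \<le> card Z"
    using Z by (intro card_mono) auto
  finally have Z_ge: "(\<Sum>i<n. card (new i \<inter> Z)) \<le> card Z" .
  \<comment> \<open>If the next step starts at a cell inside \<open>Z\<close>, both new vertices of
    the present step are in \<open>Z\<close>: one pays for this step, the other for the
    next.\<close>
  have step: "of_bool (new i \<inter> Z \<noteq> {}) + of_bool (succ i \<in> E') \<le> card (new i \<inter> Z)" if "i < n" for i
  proof (cases "succ i \<in> E'")
    case True
    then have "new i \<inter> Z = new i"
      by (auto simp: E'_def new_def)
    then show ?thesis
      using card_new[OF that] by auto
  next
    case False
    then show ?thesis
      using Z by (auto simp: of_bool_def Suc_le_eq card_gt_0_iff)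
  qed
  \<comment> \<open>The successor permutes the indices, so surpluses charged to predecessors add up
    to the number of steps in \<open>E'\<close>.\<close>
  have "bij_betw succ {..<n} {..<n}"
    unfolding bij_betw_def
    by (intro conjI endo_inj_surj) (auto simp: inj_on_def succ_inject)
  then have shift: "(\<Sum>i<n. of_bool (succ i \<in> E')) = (\<Sum>i<n. of_bool (i \<in> E') :: nat)"
    by (rule sum.reindex_bij_betw)
  have "n = (\<Sum>i<n. 1)"
    by simp
  also have "\<dots> \<le> (\<Sum>i<n. of_bool (new i \<inter> Z \<noteq> {}) + of_bool (i \<in> E') + of_bool (i \<in> E))"
    by (intro sum_mono) (auto simp: E_def E'_def free_steps_def)
  also have "\<dots> = (\<Sum>i<n. of_bool (new i \<inter> Z \<noteq> {}) + of_bool (succ i \<in> E')) + (\<Sum>i<n. of_bool (i \<in> E))"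
    by (simp add: sum.distrib shift)
  also have "\<dots> \<le> card Z + card E"
  proof (intro add_mono)
    show "(\<Sum>i<n. of_bool (new i \<inter> Z \<noteq> {}) + of_bool (succ i \<in> E')) \<le> card Z"
      by (rule order_trans[OF sum_mono Z_ge], rule step) simp
    have "E \<subseteq> {..<n}"
      by (auto simp: E_def free_steps_def)
    then show "(\<Sum>i<n. of_bool (i \<in> E)) \<le> card E"
      by (simp add: Int_absorb1)
  qed
  finally show ?thesis
    by (simp add: E_def)
qed

text \<open>The incidence of the cells \<open>A (succ j)\<close> with the chosen intervals is the
  identity matrix, which later yields linear independence of the binomials.\<close>

lemma separated_intervals:
  assumes closed: "binomial_closed P Z"
  shows "\<exists>a b. \<forall>i\<in>free_steps Z. inner_interval P (a i) (b i) \<and> corners (a i) (b i) \<inter> Z = {} \<and>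
    (\<forall>j\<in>free_steps Z. A (succ j) \<subseteq> lattice_interval (a i) (b i) \<longleftrightarrow> j = i)"
proof -
  let ?Q = "\<lambda>i a b. inner_interval P a b \<and> corners a b \<inter> Z = {} \<and> A (succ i) \<subseteq> lattice_interval a b \<and>
      (\<forall>c. cell c \<subseteq> lattice_interval a b \<longrightarrow> cell c = A (succ i) \<or> cell c = A i \<and> A (succ i) \<inter> A i \<subseteq> Z)"
  have "\<exists>a b. ?Q i a b" if "i \<in> free_steps Z" for i
    using that closed by (intro interval_avoiding A_in adjacent_succ) (auto simp: free_steps_def new_def)
  then obtain a b where ab: "\<And>i. i \<in> free_steps Z \<Longrightarrow> ?Q i (a i) (b i)"
    by metis
  have "j = i" if i: "i \<in> free_steps Z" and j: "j \<in> free_steps Z"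
    and sub: "A (succ j) \<subseteq> lattice_interval (a i) (b i)" for i j
  proof (rule ccontr)
    assume "j \<noteq> i"
    have less: "i < n" "j < n"
      using i j by (auto simp: free_steps_def)
    obtain c where c: "A (succ j) = cell c"
      using adjacent_succ[OF less(2)] by (auto simp: adjacent_def)
    have "A (succ j) \<noteq> A (succ i)"
      using less \<open>j \<noteq> i\<close> by (simp add: A_inject succ_inject)
    then have "A (succ j) = A i" "A (succ i) \<inter> A i \<subseteq> Z"
      using ab[OF i] sub unfolding c by blast+
    then have "i = succ j"
      using less by (simp add: A_inject)
    \<comment> \<open>The edge shared by \<open>A i\<close> and \<open>A (succ i)\<close> lies in
      \<open>Z\<close> but is not contained in \<open>A j\<close>; a vertex of it outside
      \<open>A j\<close> is a new vertex of step \<open>j\<close> in \<open>Z\<close>, contrary to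
      \<open>j\<close> being free.\<close>
    then obtain x where "x \<in> new j" "x \<in> Z"
      using two_steps(2)[OF less(2)] \<open>A (succ i) \<inter> A i \<subseteq> Z\<close> by (auto simp: new_def)
    then show False
      using j by (auto simp: free_steps_def)
  qed
  then show ?thesis
    using ab by (intro exI[of _ a] exI[of _ b] ballI conjI iffI) auto
qed

end

lemma closed_path_cyclic_cells:
  assumes "closed_path P"
  shows "\<exists>A. cyclic_cells P A (card P)"
proof -
  obtain As n where As: "length As = n" "n > 5" "set As = P" "distinct As"
    and edge: "\<forall>i<n. As ! i \<inter> As ! (Suc i mod n) \<in> cell_edges (As ! i) \<inter> cell_edges (As ! (Suc i mod n))"
    and far: "\<forall>i<n. \<forall>j<n. (\<forall>d\<in>{-2..2}. int j \<noteq> (int i + d) mod int n) \<longrightarrow> As ! i \<inter> As ! j = {}"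
    using assms unfolding closed_path_def by (elim conjE exE) (rule that)
  have P: "P \<subseteq> range cell"
    using assms by (auto simp: closed_path_def polyomino_def)
  have "cyclic_cells P ((!) As) n"
  proof
    show "inj_on ((!) As) {..<n}"
      using As by (auto simp: inj_on_def nth_eq_iff_index_eq)
    show "(!) As ` {..<n} = P"
      using As by (auto simp: set_conv_nth)
    fix i
    assume i: "i < n"
    show "adjacent (As ! i) (As ! (Suc i mod n))"
    proof (rule adjacent_if_common_edge)
      show "As ! i \<in> range cell" "As ! (Suc i mod n) \<in> range cell"
        using As i P by (metis nth_mem subsetD, metis As(1) mod_less_divisor nth_mem not_less_zero not_gr_zero subsetD)
      have "i \<noteq> Suc i mod n"
        using i As(2) by (auto simp: mod_Suc)
      then show "As ! i \<noteq> As ! (Suc i mod n)"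
        using As i by (simp add: nth_eq_iff_index_eq)
    qed (use edge i in blast)
    fix j
    assume j: "j < n" and "As ! i \<inter> As ! j \<noteq> {}"
    then obtain d :: int where d: "d \<in> {-2..2}" "int j = (int i + d) mod int n"
      using far i j by (metis (no_types, lifting))
    have "d = -2 \<or> d = -1 \<or> d = 0 \<or> d = 1 \<or> d = 2"
      using d(1) by auto
    \<comment> \<open>Negative offsets are turned around, so that \<open>i\<close> becomes a
      successor of \<open>j\<close>.\<close>
    moreover have "int i = (int j + (- d)) mod int n"
      using i unfolding d(2) by (simp add: mod_add_left_eq mod_diff_left_eq)
    moreover have "int (Suc k mod n) = (int k + 1) mod int n" "int (Suc (Suc k mod n) mod n) = (int k + 2) mod int n" for k
      by (simp_all add: zmod_int mod_add_right_eq mod_simps add.commute)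
    ultimately show "j \<in> {i, Suc i mod n, Suc (Suc i mod n) mod n} \<or> i \<in> {Suc j mod n, Suc (Suc j mod n) mod n}"
      using d(2) i j by (smt (verit) insert_iff of_nat_eq_iff mod_less of_nat_mod)
  qed (use As in auto)
  moreover have "card P = n"
    using As distinct_card by metis
  ultimately show ?thesis
    by blast
qed

section \<open>The height of the polyomino ideal\<close>

lemma inner_minor_eq:
  "inner_minor a b = single (single a 1 + single b 1) 1 - single (single (fst a, snd b) 1 + single (fst b, snd a) 1) 1"
  by (simp add: inner_minor_def Var_def mult_single)

lemma polyomino_ring_eq: "polyomino_ring P = polynomial_ring (polyomino_vertices P)"
  by (simp add: polyomino_ring_def polynomial_ring_def pols_def)

lemma corners_subset:
  assumes "inner_interval P a b"
  shows "corners a b \<subseteq> polyomino_vertices P"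
proof -
  have ab: "proper_interval a b"
    using assms by (simp add: inner_interval_def)
  have in_P: "cell c \<in> P" if "c \<in> {a, (fst b - 1, snd b - 1), (fst a, snd b - 1), (fst b - 1, snd a)}" for c
  proof -
    have "cell c \<subseteq> lattice_interval a b"
      using ab that unfolding cell_subset_interval[OF ab] by (auto simp: proper_interval_def)
    then show ?thesis
      using assms unfolding inner_interval_def by blast
  qed
  have "a \<in> cell a" "b \<in> cell (fst b - 1, snd b - 1)"
    "(fst a, snd b) \<in> cell (fst a, snd b - 1)" "(fst b, snd a) \<in> cell (fst b - 1, snd a)"
    by (simp_all add: mem_cell)
  then show ?thesis
    using in_P unfolding corners_def polyomino_vertices_def by blast
qed

lemma keys_pair: "keys (single a 1 + single b (1 :: nat)) \<subseteq> {a, b}"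
  by (rule order_trans[OF keys_add]) simp

lemma inner_minor_pols:
  assumes "inner_interval P a b"
  shows "inner_minor a b \<in> pols (polyomino_vertices P)"
  unfolding inner_minor_eq using corners_subset[OF assms]
  by (intro pols_diff pols_single order_trans[OF keys_pair]) (simp_all add: corners_def)

lemma finite_polyomino_vertices:
  assumes "polyomino P"
  shows "finite (polyomino_vertices P)"
  unfolding polyomino_vertices_def
proof (rule finite_Union)
  show "finite P"
    using assms by (simp add: polyomino_def)
  have "finite (cell c)" for c
    by (simp add: cell_def lattice_interval_def)
  then show "finite C" if "C \<in> P" for C
    using assms that by (auto simp: polyomino_def)
qed

lemma inner_minors_in_polyomino_ideal:
  "{inner_minor a b | a b. inner_interval P a b} \<subseteq> polyomino_ideal P"
  unfolding polyomino_ideal_def polyomino_ring_eq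
  by (rule ring.genideal_self[OF cring.axioms(1)[OF cring_polynomial_ring]])
     (auto intro: inner_minor_pols)

text \<open>The functional \<open>w\<close> is dual to the exponent vector of the cell with lower left corner \<open>c\<close>.\<close>

lemma dual_functional:
  fixes c :: point
  defines "w \<equiv> \<lambda>v :: point. if fst c < fst v \<and> snd c < snd v then 1 else 0 :: int"
  assumes "proper_interval a b" "finite U" "corners a b \<subseteq> U"
  shows "(\<Sum>v\<in>U. (int (lookup (single a 1 + single b 1) v) -
      int (lookup (single (fst a, snd b) 1 + single (fst b, snd a) 1) v)) * w v)
    = (if cell c \<subseteq> lattice_interval a b then 1 else 0)"
proof -
  have single: "(\<Sum>v\<in>U. int (lookup (single u 1) v) * w v) = w u" if "u \<in> corners a b" for u
  proof -
    have "(\<Sum>v\<in>U. int (lookup (single u 1) v) * w v) = (\<Sum>v\<in>U. if v = u then w v else 0)"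
      by (intro sum.cong) (auto simp: lookup_single when_def)
    then show ?thesis
      using that assms(3,4) by auto
  qed
  have "(\<Sum>v\<in>U. (int (lookup (single a 1 + single b 1) v) -
      int (lookup (single (fst a, snd b) 1 + single (fst b, snd a) 1) v)) * w v)
    = w a + w b - (w (fst a, snd b) + w (fst b, snd a))"
    using single[of a] single[of b] single[of "(fst a, snd b)"] single[of "(fst b, snd a)"]
    by (simp add: corners_def lookup_add algebra_simps sum.distrib sum_subtractf)
  \<comment> \<open>The mixed difference of the indicator of the open quadrant at \<open>c\<close>
    is the product of two one-dimensional differences, each 1 exactly when its coordinate of
    \<open>c\<close> falls in the side of the interval.\<close>
  also have "\<dots> = (if cell c \<subseteq> lattice_interval a b then 1 else 0)"
    using assms(2) unfolding cell_subset_interval[OF assms(2)]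
    by (auto simp: w_def proper_interval_def)
  finally show ?thesis .
qed

lemma prime_height_ge_rank:
  assumes "closed_path P" and p: "polynomial_prime (polyomino_vertices P) p"
    and minors: "\<And>a b. inner_interval P a b \<Longrightarrow> inner_minor a b \<in> (p :: 'k::field mpoly set)"
  shows "enat (card P) \<le> prime_height (polynomial_ring (polyomino_vertices P)) p"
proof (rule prime_height_ge[OF _ p])
  define V where "V = polyomino_vertices P"
  show "finite (polyomino_vertices P)"
    using assms(1) by (simp add: closed_path_def finite_polyomino_vertices)
  then have V: "finite V"
    by (simp add: V_def)
  interpret polynomial_prime V p
    unfolding V_def by (rule p)
  obtain A where "cyclic_cells P A (card P)"
    using closed_path_cyclic_cells[OF assms(1)] by blast
  then interpret cyclic_cells P A "card P" .
  define Z where "Z = {v \<in> V. single (single v 1) 1 \<in> p}"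
  define U where "U = {v \<in> V. single (single v 1) 1 \<notin> p}"
  have corners: "corners a b \<subseteq> V" if "inner_interval P a b" for a b
    using corners_subset[OF that] by (simp add: V_def)
  have vanish: "a \<in> Z \<or> b \<in> Z \<longleftrightarrow> single (single a 1 + single b 1) 1 \<in> p" if "a \<in> V" "b \<in> V" for a b
  proof -
    let ?x = "\<lambda>v. single (single v 1) 1 :: 'k mpoly"
    have x: "?x a \<in> pols V" "?x b \<in> pols V"
      using that by (auto intro!: pols_single)
    have eq: "single (single a 1 + single b 1) 1 = ?x a * ?x b"
      by (simp add: mult_single)
    show ?thesis
      unfolding eq Z_def using that prime[OF x] mult[of "?x b" "?x a"] mult[of "?x a" "?x b"] x
      by (auto simp: mult.commute)
  qed
  have "binomial_closed P Z"
    unfolding binomial_closed_def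
  proof (intro allI impI)
    fix a b
    assume ab: "inner_interval P a b"
    let ?m = "single (single a 1 + single b 1) 1 :: 'k mpoly"
    let ?m' = "single (single (fst a, snd b) 1 + single (fst b, snd a) 1) 1 :: 'k mpoly"
    have "?m - ?m' \<in> p"
      using minors[OF ab] by (simp add: inner_minor_eq)
    then have "?m \<in> p \<longleftrightarrow> ?m' \<in> p"
      using add[of "?m - ?m'" ?m'] diff[of ?m "?m - ?m'"] by auto
    then show "a \<in> Z \<or> b \<in> Z \<longleftrightarrow> (fst a, snd b) \<in> Z \<or> (fst b, snd a) \<in> Z"
      using corners[OF ab] vanish[of a b] vanish[of "(fst a, snd b)" "(fst b, snd a)"]
      by (simp add: corners_def)
  qed
  then obtain a b where ab: "\<forall>i\<in>free_steps Z. inner_interval P (a i) (b i) \<and> corners (a i) (b i) \<inter> Z = {} \<and>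
      (\<forall>j\<in>free_steps Z. A (succ j) \<subseteq> lattice_interval (a i) (b i) \<longleftrightarrow> j = i)"
    using separated_intervals by blast
  define \<alpha> where "\<alpha> i = single (a i) 1 + single (b i) (1 :: nat)" for i
  define \<beta> where "\<beta> i = single (fst (a i), snd (b i)) 1 + single (fst (b i), snd (a i)) (1 :: nat)" for i
  have U: "corners (a i) (b i) \<subseteq> U" if "i \<in> free_steps Z" for i
    using ab that corners[of "a i" "b i"] unfolding U_def Z_def by blast
  have "finite U"
    using V by (simp add: U_def)
  have "finite (free_steps Z)"
    by (simp add: free_steps_def)
  have rank: "card P \<le> card Z + card (free_steps Z)"
    using V by (intro rank_le) (simp add: Z_def)
  fix T
  assume T: "T \<subseteq> polyomino_vertices P" "p \<inter> pols T \<subseteq> {0}"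
  have "card T + card (free_steps Z) \<le> card U"
  proof (rule card_indep_variables_le)
    show "congruent_monomials p U (\<alpha> i) (\<beta> i)" if "i \<in> free_steps Z" for i
    proof -
      have "single (\<alpha> i) 1 - single (\<beta> i) 1 \<in> p"
        using minors ab that unfolding inner_minor_eq \<alpha>_def \<beta>_def by blast
      moreover have "keys (\<alpha> i) \<subseteq> corners (a i) (b i)" "keys (\<beta> i) \<subseteq> corners (a i) (b i)"
        unfolding \<alpha>_def \<beta>_def corners_def by (rule order_trans[OF keys_pair]; simp)+
      ultimately show ?thesis
        using U[OF that] by (auto simp: congruent_monomials_def)
    qed
    fix c
    assume zero: "\<And>v. v \<in> U \<Longrightarrow>
      (\<Sum>i\<in>free_steps Z. (int (lookup (\<alpha> i) v) - int (lookup (\<beta> i) v)) * c i) = 0"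
    show "\<forall>j\<in>free_steps Z. c j = 0"
    proof
      fix j
      assume j: "j \<in> free_steps Z"
      then obtain k where k: "A (succ j) = cell k"
        using adjacent_succ[of j] by (auto simp: free_steps_def adjacent_def)
      define w where "w v = (if fst k < fst v \<and> snd k < snd v then 1 else 0 :: int)" for v :: point
      have pairing: "(\<Sum>v\<in>U. (int (lookup (\<alpha> i) v) - int (lookup (\<beta> i) v)) * w v) = (if i = j then 1 else 0)"
        if "i \<in> free_steps Z" for i
        using ab that j dual_functional[of "a i" "b i" U k] \<open>finite U\<close> U[OF that]
        by (auto simp: \<alpha>_def \<beta>_def w_def inner_interval_def simp flip: k)
      \<comment> \<open>Pairing the vanishing combination with \<open>w\<close> isolates
        \<open>c j\<close>, since only the interval of step \<open>j\<close> contains the cell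
        \<open>A (succ j)\<close>.\<close>
      have "0 = (\<Sum>v\<in>U. (\<Sum>i\<in>free_steps Z. (int (lookup (\<alpha> i) v) - int (lookup (\<beta> i) v)) * c i) * w v)"
        by (simp add: zero)
      also have "\<dots> = (\<Sum>i\<in>free_steps Z. (\<Sum>v\<in>U. (int (lookup (\<alpha> i) v) - int (lookup (\<beta> i) v)) * w v) * c i)"
        unfolding sum_distrib_right by (subst sum.swap) (simp add: mult_ac)
      also have "\<dots> = (\<Sum>i\<in>free_steps Z. (if i = j then c i else 0))"
        by (intro sum.cong) (auto simp: pairing)
      also have "\<dots> = c j"
        using j \<open>finite (free_steps Z)\<close> by simp
      finally show "c j = 0"
        by simp
    qed
  qed (use V T \<open>finite (free_steps Z)\<close> in \<open>simp_all add: V_def U_def\<close>)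
  moreover have "card V = card Z + card U"
  proof -
    have "V = Z \<union> U" "Z \<inter> U = {}"
      by (auto simp: Z_def U_def)
    then show ?thesis
      using V by (metis card_Un_disjoint finite_Un)
  qed
  \<comment> \<open>With \<open>F\<close> the set of free steps, card T + card P \<le> card T + card
    Z + card F \<le> card Z + card U = card V.\<close>
  ultimately show "card T + card P \<le> card (polyomino_vertices P)"
    using rank by (simp add: V_def)
qed

section \<open>A toric prime of height at most the rank\<close>

text \<open>Mixed differences add up when rectangles are glued along a side, so the cell equations
  imply those of all inner intervals. The outer induction glues strips of width one, the inner one
  builds a strip from cells.\<close>

lemma mixed_difference_zero:
  fixes f :: "int \<Rightarrow> int \<Rightarrow> int"
  assumes "i \<le> k" "j \<le> l"
    and cells: "\<And>x y. i \<le> x \<Longrightarrow> x < k \<Longrightarrow> j \<le> y \<Longrightarrow> y < l \<Longrightarrow> f x y + f (x + 1) (y + 1) = f x (y + 1) + f (x + 1) y"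
  shows "f i j + f k l = f i l + f k j"
  using assms(1) cells
proof (induction k rule: int_ge_induct)
  case (step k)
  have "f k j + f (k + 1) l = f k l + f (k + 1) j"
    using assms(2) step.prems
  proof (induction l rule: int_ge_induct)
    case (step l)
    then show ?case
      using step.prems[of k l] \<open>i \<le> k\<close> by fastforce
  qed simp
  moreover have "f i j + f k l = f i l + f k j"
    by (rule step.IH) (simp add: step.prems)
  ultimately show ?case
    by simp
qed simp

text \<open>The witness is the toric prime of a lattice of integer solutions of the cell equations
  \<open>w a + w b = w c + w d\<close>; elimination leaves at least \<open>card V - card P\<close> free vertices.\<close>

lemma prime_of_height_le_rank:
  assumes "closed_path P"
  shows "\<exists>p :: 'k::field mpoly set. polynomial_prime (polyomino_vertices P) p \<and> polyomino_ideal P \<subseteq> p \<and>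
    prime_height (polynomial_ring (polyomino_vertices P)) p \<le> enat (card P)"
proof -
  define V where "V = polyomino_vertices P"
  define Q where "Q = {c. cell c \<in> P}"
  have poly: "polyomino P"
    using assms by (simp add: closed_path_def)
  then have V: "finite V"
    by (simp add: V_def finite_polyomino_vertices)
  have "cell ` Q = P" "inj_on cell Q"
    using poly by (auto simp: Q_def polyomino_def inj_on_def cell_inj)
  then have Q: "finite Q" "card Q = card P"
    using poly by (metis finite_imageD polyomino_def, metis card_image)
  \<comment> \<open>The exponent vector of the minor of the cell at \<open>c\<close>: 1 at the
    diagonal corners, -1 at the anti-diagonal ones.\<close>
  define eqn where "eqn c v = (if v = c \<or> v = (fst c + 1, snd c + 1) then 1
      else if v = (fst c, snd c + 1) \<or> v = (fst c + 1, snd c) then -1 else 0 :: int)" for c v :: point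
  obtain B w where B: "B \<subseteq> V" "card V \<le> card B + card Q"
    and sol: "\<forall>b\<in>B. w b b \<noteq> 0 \<and> (\<forall>b'\<in>B - {b}. w b b' = 0) \<and> (\<forall>c\<in>Q. (\<Sum>v\<in>V. eqn c v * w b v) = 0)"
    using elimination[OF Q(1) V, of eqn] by (elim exE conjE) (rule that)
  have w: "w b b \<noteq> 0" "\<And>b'. b' \<in> B - {b} \<Longrightarrow> w b b' = 0"
    "\<And>c. c \<in> Q \<Longrightarrow> (\<Sum>v\<in>V. eqn c v * w b v) = 0" if "b \<in> B" for b
    using sol that by (blast, blast, blast)
  have "finite B"
    using B(1) V by (rule finite_subset)
  \<comment> \<open>Coordinate \<open>b\<close> pairs the exponent vector with the solution
    \<open>w b\<close>. Solutions may take negative values, hence Laurent monomials in the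
    target.\<close>
  define h :: "(point \<Rightarrow>\<^sub>0 nat) \<Rightarrow> (point \<Rightarrow>\<^sub>0 int)" where
    "h m = (\<Sum>b\<in>B. single b (\<Sum>v\<in>V. int (lookup m v) * w b v))" for m
  have lookup_h: "lookup (h m) b = (\<Sum>v\<in>V. int (lookup m v) * w b v)" if "b \<in> B" for m b
    using that \<open>finite B\<close> by (simp add: h_def lookup_sum lookup_single when_def)
  have h_add: "h (m + m') = h m + h m'" for m m'
    by (simp add: h_def lookup_add distrib_right sum.distrib single_add)
  define p where "p = (toric_ideal h V :: 'k mpoly set)"
  have prime: "polynomial_prime V p"
    unfolding p_def by (rule polynomial_prime_toric_ideal) (rule h_add)
  have cell_eqn: "w b (x, y) + w b (x + 1, y + 1) = w b (x, y + 1) + w b (x + 1, y)"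
    if b: "b \<in> B" and c: "cell (x, y) \<in> P" for b x y
  proof -
    have "{(x, y), (x + 1, y + 1), (x, y + 1), (x + 1, y)} \<subseteq> V"
      using c unfolding V_def polyomino_vertices_def cell_eq by blast
    then have "(\<Sum>v\<in>V. eqn (x, y) v * w b v) =
        (\<Sum>v\<in>{(x, y), (x + 1, y + 1), (x, y + 1), (x + 1, y)}. eqn (x, y) v * w b v)"
      using V by (intro sum.mono_neutral_right) (auto simp: eqn_def)
    also have "\<dots> = w b (x, y) + w b (x + 1, y + 1) - w b (x, y + 1) - w b (x + 1, y)"
      by (simp add: eqn_def)
    finally show ?thesis
      using w(3)[OF b, of "(x, y)"] c by (simp add: Q_def)
  qed
  have interval_eqn: "w b a + w b a' = w b (fst a, snd a') + w b (fst a', snd a)"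
    if b: "b \<in> B" and a: "inner_interval P a a'" for b a a'
  proof -
    have proper: "proper_interval a a'"
      using a by (simp add: inner_interval_def)
    have "cell (x, y) \<in> P" if "fst a \<le> x" "x < fst a'" "snd a \<le> y" "y < snd a'" for x y
      using a that unfolding inner_interval_def by (simp add: cell_subset_interval)
    then show ?thesis
      using mixed_difference_zero[of "fst a" "fst a'" "snd a" "snd a'" "\<lambda>x y. w b (x, y)"]
        cell_eqn[OF b] proper by (simp add: proper_interval_def)
  qed
  have single_sum: "(\<Sum>v\<in>V. int (lookup (single u 1) v) * w b v) = w b u" if "u \<in> V" for u b
  proof -
    have "(\<Sum>v\<in>V. int (lookup (single u 1) v) * w b v) = (\<Sum>v\<in>V. if v = u then w b v else 0)"
      by (intro sum.cong) (auto simp: lookup_single when_def)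
    then show ?thesis
      using that V by simp
  qed
  have "inner_minor a a' \<in> p" if a: "inner_interval P a a'" for a a'
  proof -
    have V4: "a \<in> V" "a' \<in> V" "(fst a, snd a') \<in> V" "(fst a', snd a) \<in> V"
      using corners_subset[OF a] by (simp_all add: corners_def V_def)
    have "h (single a 1 + single a' 1) = h (single (fst a, snd a') 1 + single (fst a', snd a) 1)"
      unfolding h_def lookup_add of_nat_add distrib_right sum.distrib
      using V4 by (intro sum.cong refl) (simp only: single_sum interval_eqn[OF _ a])
    then show ?thesis
      using inner_minor_pols[OF a]
      by (simp add: p_def toric_ideal_def inner_minor_eq map_exponents_diff V_def)
  qed
  then have I: "polyomino_ideal P \<subseteq> p"
    unfolding polyomino_ideal_def polyomino_ring_eq
    using prime primeideal_polynomial_ring_iff[of p V] cring.axioms(1)[OF cring_polynomial_ring]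
    by (intro ring.genideal_minimal) (auto simp: V_def primeideal_def)
  \<comment> \<open>On monomials supported in \<open>B\<close> the map \<open>h\<close> is diagonal
    with nonzero entries \<open>w b b\<close>, because \<open>w b\<close> vanishes at the other
    members of \<open>B\<close>.\<close>
  have "inj_on h {m. keys m \<subseteq> B}"
  proof (rule inj_onI)
    have lookup_B: "lookup (h m) b = int (lookup m b) * w b b" if "keys m \<subseteq> B" "b \<in> B" for m b
    proof -
      have "(\<Sum>v\<in>V. int (lookup m v) * w b v) = (\<Sum>v\<in>{b}. int (lookup m v) * w b v)"
      proof (rule sum.mono_neutral_right)
        show "\<forall>v\<in>V - {b}. int (lookup m v) * w b v = 0"
        proof
          fix v
          assume "v \<in> V - {b}"
          then have "lookup m v = 0 \<or> w b v = 0"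
            using that w(2)[of b v] in_keys_iff[of v m] by blast
          then show "int (lookup m v) * w b v = 0"
            by auto
        qed
      qed (use V B that in auto)
      then show ?thesis
        using that by (simp add: lookup_h)
    qed
    fix m m'
    assume m: "m \<in> {m. keys m \<subseteq> B}" "m' \<in> {m. keys m \<subseteq> B}" "h m = h m'"
    show "m = m'"
    proof (rule poly_mapping_eqI)
      fix v
      show "lookup m v = lookup m' v"
      proof (cases "v \<in> B")
        case True
        then show ?thesis
          using lookup_B[of m v] lookup_B[of m' v] m w(1) by simp
      next
        case False
        then have "v \<notin> keys m" "v \<notin> keys m'"
          using m by auto
        then show ?thesis
          by (simp add: in_keys_iff)
      qed
    qed
  qed
  then have indep: "alg_indep p ((\<lambda>b. single (single b 1) 1) ` B)"
    unfolding p_def by (intro alg_indep_variables \<open>finite B\<close> toric_ideal_Int_pols)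
  have "inj (\<lambda>b. single (single b 1) 1 :: 'k mpoly)"
    by (intro injI) (metis lookup_single_eq lookup_single_not_eq one_neq_zero)
  then have card: "card ((\<lambda>b. single (single b 1) 1 :: 'k mpoly) ` B) = card B"
    by (intro card_image) (auto simp: inj_on_def)
  have "prime_height (polynomial_ring V) p \<le> enat (card V - card ((\<lambda>b. single (single b 1) 1 :: 'k mpoly) ` B))"
    using V \<open>finite B\<close> B(1) indep by (intro prime_height_le image_subsetI pols_single) auto
  also have "\<dots> \<le> enat (card P)"
    unfolding card using B(2) Q(2) by simp
  finally show ?thesis
    using prime I unfolding V_def by blast
qed

theorem corollary3p6:
  fixes P :: "point set set"
  assumes "closed_path P"
  shows "ideal_height (polyomino_ring P :: 'k::field mpoly ring) (polyomino_ideal P)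
           = enat (polyomino_rank P)"
proof (rule antisym)
  obtain p :: "'k mpoly set" where p: "polynomial_prime (polyomino_vertices P) p" "polyomino_ideal P \<subseteq> p"
    "prime_height (polynomial_ring (polyomino_vertices P)) p \<le> enat (card P)"
    using prime_of_height_le_rank[OF assms] by blast
  then have "ideal_height (polynomial_ring (polyomino_vertices P)) (polyomino_ideal P :: 'k mpoly set)
      \<le> prime_height (polynomial_ring (polyomino_vertices P)) p"
    unfolding ideal_height_def primeideal_polynomial_ring_iff by (intro INF_lower) simp
  with p(3) show "ideal_height (polyomino_ring P :: 'k mpoly ring) (polyomino_ideal P) \<le> enat (polyomino_rank P)"
    unfolding polyomino_ring_eq polyomino_rank_def by (rule order_trans[rotated])
  have "enat (card P) \<le> prime_height (polynomial_ring (polyomino_vertices P)) p"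
    if "polynomial_prime (polyomino_vertices P) p" "polyomino_ideal P \<subseteq> p" for p :: "'k mpoly set"
    using inner_minors_in_polyomino_ideal that by (intro prime_height_ge_rank[OF assms]) blast+
  then show "enat (polyomino_rank P) \<le> ideal_height (polyomino_ring P :: 'k mpoly ring) (polyomino_ideal P)"
    unfolding ideal_height_def polyomino_ring_eq primeideal_polynomial_ring_iff polyomino_rank_def
    by (intro INF_greatest) auto
qed

end
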